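(* Let $n,d\in\mathbb N=\{1,2,\dots\}$. The identity $\Sigma_{n,2d}\cup C_{n,2d}=(\Sigma+C)_{n,2d}$ holds if and only if $(n,2d)$ is a Hilbert case.
   Context: The Hilbert cases are the pairs $(n,2d)\in\{(2,2d),(n,2),(3,4)\}$, i.e. those with $n=2$, or $2d=2$, or $(n,2d)=(3,4)$. $H_{n,k}$ is the real vector space of forms of degree $k$ in $n$ variables. $\Sigma_{n,2d}\subseteq H_{n,2d}$ is the set of finite sums of squares of forms in $H_{n,d}$. For $f=\sum_\alpha f_\alpha x^\alpha\in H_{n,2d}$: $\operatorname{supp}(f)=\{\alpha\in\mathbb N_0^n:f_\alpha\neq0\}$, $\operatorname{New}(f)=\operatorname{conv}(\operatorname{supp}(f))$, $V(f)$ is the vertex set of $\operatorname{New}(f)$, $\mathcal S(f)=\{\alpha\in\operatorname{supp}(f):\alpha\in(2\mathbb N_0)^n,\ f_\alpha>0\}$, $\mathcal I(f)=\operatorname{supp}(f)\setminus\mathcal S(f)$. A form $f\in H_{n,2d}$ is a circuit if $\mathcal S(f)=V(f)$, $V(f)$ is affinely independent (single points and the empty set count as affinely independent), and either $\mathcal I(f)=\emptyset$ or $\mathcal I(f)=\{\beta\}$ with $\beta$ in the relative interior of $\operatorname{New}(f)$. It is a nonnegative circuit if moreover $f\ge0$ on $\mathbb R^n$. $C_{n,2d}$ is the set of all finite sums of nonnegative circuits in $H_{n,2d}$. $(\Sigma+C)_{n,2d}=\{g+h: g\in\Sigma_{n,2d},\ h\in C_{n,2d}\}$.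
   Formalization: The pairs (1,2d) with d ≥ 2 are excluded: there Σ, C and Σ+C all equal {c x^{2d} : c ≥ 0}, so the identity holds although (1,2d) is not a Hilbert case as defined, and the stated equivalence fails for these pairs. *)

theory Defs
  imports "HOL-Analysis.Analysis" "HOL-Library.Poly_Mapping"
begin

text \<open>
  Real polynomials in \<open>n = CARD('n)\<close> variables indexed by \<open>'n\<close>: finitely supported maps from
  exponent vectors to coefficients, with the convolution product of \<open>Poly_Mapping\<close>.
\<close>

type_synonym 'n mpol = "(nat ^ 'n) \<Rightarrow>\<^sub>0 real"

definition mpol_eval :: "('n::finite) mpol \<Rightarrow> real ^ 'n \<Rightarrow> real" where
  "mpol_eval f x = (\<Sum>\<alpha>\<in>Poly_Mapping.keys f. Poly_Mapping.lookup f \<alpha> * (\<Prod>i\<in>UNIV. (x $ i) ^ (\<alpha> $ i)))"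

text \<open>As in the usual convention, the zero polynomial belongs to every \<open>forms k\<close>.\<close>

definition forms :: "nat \<Rightarrow> ('n::finite) mpol set" where
  "forms k = {f. \<forall>\<alpha>\<in>Poly_Mapping.keys f. (\<Sum>i\<in>UNIV. \<alpha> $ i) = k}"

definition sos :: "nat \<Rightarrow> ('n::finite) mpol set" where
  "sos d = {f. \<exists>(m::nat) g. (\<forall>j<m. g j \<in> forms d) \<and> f = (\<Sum>j<m. (g j)\<^sup>2)}"

definition real_vec :: "nat ^ 'n \<Rightarrow> real ^ ('n::finite)" where
  "real_vec \<alpha> = (\<chi> i. real (\<alpha> $ i))"

definition newton_polytope :: "('n::finite) mpol \<Rightarrow> (real ^ 'n) set" where
  "newton_polytope f = convex hull (real_vec ` Poly_Mapping.keys f)"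

definition newton_vertices :: "('n::finite) mpol \<Rightarrow> (real ^ 'n) set" where
  "newton_vertices f = {v. v extreme_point_of newton_polytope f}"

definition square_supp :: "('n::finite) mpol \<Rightarrow> (nat ^ 'n) set" where
  "square_supp f = {\<alpha> \<in> Poly_Mapping.keys f. (\<forall>i. even (\<alpha> $ i)) \<and> Poly_Mapping.lookup f \<alpha> > 0}"

definition inner_supp :: "('n::finite) mpol \<Rightarrow> (nat ^ 'n) set" where
  "inner_supp f = Poly_Mapping.keys f - square_supp f"

definition circuit :: "('n::finite) mpol \<Rightarrow> bool" where
  "circuit f \<longleftrightarrow>
     real_vec ` square_supp f = newton_vertices f \<and>
     \<not> affine_dependent (newton_vertices f) \<and>
     (inner_supp f = {} \<or>
      (\<exists>\<beta>. inner_supp f = {\<beta>} \<and> real_vec \<beta> \<in> rel_interior (newton_polytope f)))"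

definition nonneg_circuit :: "('n::finite) mpol \<Rightarrow> bool" where
  "nonneg_circuit f \<longleftrightarrow> circuit f \<and> (\<forall>x. mpol_eval f x \<ge> 0)"

definition sonc :: "nat \<Rightarrow> ('n::finite) mpol set" where
  "sonc k = {f. \<exists>(m::nat) h. (\<forall>j<m. h j \<in> forms k \<and> nonneg_circuit (h j)) \<and> f = (\<Sum>j<m. h j)}"

definition sos_plus_sonc :: "nat \<Rightarrow> ('n::finite) mpol set" where
  "sos_plus_sonc d = {g + h | g h. g \<in> sos d \<and> h \<in> sonc (2 * d)}"

text \<open>The second argument is the degree \<open>2d\<close>, not \<open>d\<close>.\<close>

definition hilbert_case :: "nat \<Rightarrow> nat \<Rightarrow> bool" where
  "hilbert_case n k \<longleftrightarrow> n = 2 \<or> k = 2 \<or> (n = 3 \<and> k = 4)"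

text \<open>
  With this definition \<open>(1, 2d)\<close> is a Hilbert case only for \<open>d = 1\<close>.  In one variable, however,
  \<open>sos d\<close>, \<open>sonc (2 * d)\<close> and \<open>sos_plus_sonc d\<close> all consist of the monomials \<open>c x^(2d)\<close> with
  \<open>c \<ge> 0\<close>, for every \<open>d\<close>; an equivalence between the collapse of these sets and being a
  Hilbert case therefore has to leave out \<open>n = 1\<close>, \<open>d \<ge> 2\<close>.
\<close>

end

theory Submission
  imports Defs "HOL-Computational_Algebra.Polynomial"
begin

text \<open>
  In the Hilbert cases every nonnegative circuit is a sum of squares. If the inner exponent involves
  at most two variables, then restricting to these variables gives a nonnegative binary form, which
  is a sum of squares because a nonnegative univariate polynomial is: subtract its minimum and split
  off the double root. All other terms are squares of monomials with positive coefficients. The only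
  remaining case is a ternary quartic with inner monomial \<open>x\<^sup>2yz\<close>; since a circuit has at most three
  vertices there, few shapes are left, and each one reduces to binary quadratic forms in monomials.

  Otherwise take a circuit that is not a sum of squares (the Motzkin form times an even power of a
  variable, or the Choi-Lam quartic in four variables) and add the square of the sum of the square
  roots of its vertex monomials. The half Newton polytope stays the same, so the coefficient of the
  inner monomial still rules out a sum of squares. The mixed terms of the new square rule out a sum
  of nonnegative circuits, because such a sum stays nonnegative at the all-ones vector when all
  coefficients of monomials that are not squares are negated.
\<close>

subsection \<open>Sums of squares of forms\<close>

abbreviation mdeg :: "nat ^ ('n::finite) \<Rightarrow> nat" where
  "mdeg \<alpha> \<equiv> (\<Sum>i\<in>UNIV. \<alpha> $ i)"

lemma poly_mapping_sum_singles:
  assumes "finite A" "Poly_Mapping.keys f \<subseteq> A"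
  shows "f = (\<Sum>\<alpha>\<in>A. Poly_Mapping.single \<alpha> (Poly_Mapping.lookup f \<alpha>))"
proof (rule poly_mapping_eqI)
  fix k
  have "Poly_Mapping.lookup (\<Sum>\<alpha>\<in>A. Poly_Mapping.single \<alpha> (Poly_Mapping.lookup f \<alpha>)) k
      = (\<Sum>\<alpha>\<in>A. if \<alpha> = k then Poly_Mapping.lookup f k else 0)"
    unfolding lookup_sum by (intro sum.cong) (auto simp: lookup_single when_def)
  also have "\<dots> = Poly_Mapping.lookup f k"
    using assms by (auto simp: sum.delta' in_keys_iff)
  finally show "Poly_Mapping.lookup f k
      = Poly_Mapping.lookup (\<Sum>\<alpha>\<in>A. Poly_Mapping.single \<alpha> (Poly_Mapping.lookup f \<alpha>)) k" ..
qed

lemma mpol_eval_superset: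
  assumes "finite A" "Poly_Mapping.keys f \<subseteq> A"
  shows "mpol_eval f x = (\<Sum>\<alpha>\<in>A. Poly_Mapping.lookup f \<alpha> * (\<Prod>i\<in>UNIV. (x $ i) ^ (\<alpha> $ i)))"
  unfolding mpol_eval_def using assms
  by (intro sum.mono_neutral_left) (auto simp: in_keys_iff)

lemma mpol_eval_zero [simp]: "mpol_eval 0 x = 0"
  by (simp add: mpol_eval_def)

lemma mpol_eval_add: "mpol_eval (f + g) x = mpol_eval f x + mpol_eval g x"
proof -
  let ?A = "Poly_Mapping.keys f \<union> Poly_Mapping.keys g"
  have "Poly_Mapping.keys (f + g) \<subseteq> ?A"
    by (rule keys_add)
  then show ?thesis
    by (simp add: mpol_eval_superset[of ?A] lookup_add sum.distrib distrib_right)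
qed

lemma mpol_eval_single:
  "mpol_eval (Poly_Mapping.single \<alpha> c) x = c * (\<Prod>i\<in>UNIV. (x $ i) ^ (\<alpha> $ i))"
  by (subst mpol_eval_superset[of "{\<alpha>}"]) auto

lemma mpol_eval_sum: "mpol_eval (\<Sum>a\<in>A. f a) x = (\<Sum>a\<in>A. mpol_eval (f a) x)"
  by (induction A rule: infinite_finite_induct) (auto simp: mpol_eval_add)

section \<open>Closure properties of forms and of sums of squares\<close>

lemma zero_in_forms [simp]: "0 \<in> forms k"
  by (simp add: forms_def)

lemma single_in_forms: "mdeg \<alpha> = k \<Longrightarrow> Poly_Mapping.single \<alpha> c \<in> forms k"
  by (auto simp: forms_def)

lemma forms_add: "f \<in> forms k \<Longrightarrow> g \<in> forms k \<Longrightarrow> f + g \<in> forms k"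
  unfolding forms_def using keys_add[of f g] by blast

lemma forms_sum: "(\<And>a. a \<in> A \<Longrightarrow> f a \<in> forms k) \<Longrightarrow> (\<Sum>a\<in>A. f a) \<in> forms k"
  by (induction A rule: infinite_finite_induct) (auto simp: forms_add)

lemma forms_mult: "f \<in> forms k \<Longrightarrow> g \<in> forms l \<Longrightarrow> f * g \<in> forms (k + l)"
  unfolding forms_def using keys_mult[of f g] by (fastforce simp: sum.distrib)

lemma zero_in_sos [simp]: "0 \<in> sos d"
  unfolding sos_def by (auto intro!: exI[of _ 0])

lemma sos_add_square:
  assumes "s \<in> sos d" "g \<in> forms d"
  shows "s + g\<^sup>2 \<in> sos d"
proof -
  obtain m :: nat and h where h: "\<forall>j<m. h j \<in> forms d" "s = (\<Sum>j<m. (h j)\<^sup>2)"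
    using assms(1) by (auto simp: sos_def)
  have "s + g\<^sup>2 = (\<Sum>j<Suc m. ((h(m := g)) j)\<^sup>2)"
    using h(2) by simp
  moreover have "\<forall>j<Suc m. (h(m := g)) j \<in> forms d"
    using h(1) assms(2) by (auto simp: less_Suc_eq)
  ultimately show ?thesis
    unfolding sos_def by blast
qed

text \<open>Lets closure properties be proved by adding one square at a time, without reindexing the
  families in the definition of \<open>sos\<close>.\<close>

lemma sos_induct [consumes 1, case_names zero add_square]:
  assumes "f \<in> sos d" "P 0"
    and "\<And>s g. s \<in> sos d \<Longrightarrow> g \<in> forms d \<Longrightarrow> P s \<Longrightarrow> P (s + g\<^sup>2)"
  shows "P f"
proof -
  obtain m :: nat and h where h: "\<forall>j<m. h j \<in> forms d" "f = (\<Sum>j<m. (h j)\<^sup>2)"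
    using assms(1) by (auto simp: sos_def)
  have "k \<le> m \<Longrightarrow> (\<Sum>j<k. (h j)\<^sup>2) \<in> sos d \<and> P (\<Sum>j<k. (h j)\<^sup>2)" for k
  proof (induction k)
    case 0
    then show ?case using assms(2) by simp
  next
    case (Suc k)
    then have "h k \<in> forms d" using h(1) by simp
    then show ?case using Suc assms(3)[of "\<Sum>j<k. (h j)\<^sup>2" "h k"]
      by (simp add: sos_add_square)
  qed
  then show ?thesis using h(2) by simp
qed

lemma sos_add:
  assumes "s \<in> sos d" "t \<in> sos d"
  shows "s + t \<in> sos d"
  using assms(2) by (induction rule: sos_induct)
    (use assms(1) sos_add_square in \<open>auto simp: add.assoc[symmetric]\<close>)

lemma square_in_sos: "g \<in> forms d \<Longrightarrow> g\<^sup>2 \<in> sos d"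
  using sos_add_square[of 0 d g] by simp

lemma sos_sum: "(\<And>a. a \<in> A \<Longrightarrow> f a \<in> sos d) \<Longrightarrow> (\<Sum>a\<in>A. f a) \<in> sos d"
  by (induction A rule: infinite_finite_induct) (auto simp: sos_add)

lemma sos_mult_square:
  assumes "s \<in> sos d" "g \<in> forms e"
  shows "g\<^sup>2 * s \<in> sos (d + e)"
  using assms(1)
proof (induction rule: sos_induct)
  case (add_square s h)
  then have "g\<^sup>2 * s + (h * g)\<^sup>2 \<in> sos (d + e)"
    by (intro sos_add_square forms_mult assms)
  then show ?case
    by (simp add: power_mult_distrib distrib_left mult.commute)
qed simp

lemma even_single_in_sos:
  assumes "\<And>i. even (\<alpha> $ i)" "mdeg \<alpha> = 2 * d" "c \<ge> 0"
  shows "Poly_Mapping.single \<alpha> c \<in> sos d"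
proof -
  define \<gamma> where "\<gamma> = (\<chi> i. \<alpha> $ i div 2)"
  have "\<alpha> $ i div 2 + \<alpha> $ i div 2 = \<alpha> $ i" for i
    using assms(1)[of i] by presburger
  then have \<alpha>: "\<alpha> = \<gamma> + \<gamma>"
    by (simp add: \<gamma>_def vec_eq_iff)
  then have "mdeg \<gamma> = d"
    using assms(2) by (simp add: sum.distrib)
  then have "(Poly_Mapping.single \<gamma> (sqrt c))\<^sup>2 \<in> sos d"
    by (intro square_in_sos single_in_forms)
  then show ?thesis
    using assms(3) by (simp add: power2_eq_square mult_single \<alpha>)
qed

text \<open>Completing the square writes a nonnegative quadratic form in two variables as a sum of
  squares of linear forms, and monomials of degree \<open>d\<close> may then be substituted for the
  variables. The ternary quartic circuits are reduced to this case.\<close>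

lemma monomial_quadratic_in_sos:
  assumes "mdeg \<mu> = d" "mdeg \<nu> = d" and nonneg: "\<And>s t. a * s\<^sup>2 + k * s * t + b * t\<^sup>2 \<ge> 0"
  shows "Poly_Mapping.single (\<mu> + \<mu>) a + Poly_Mapping.single (\<mu> + \<nu>) k
    + Poly_Mapping.single (\<nu> + \<nu>) b \<in> sos d"
proof -
  have "a \<ge> 0" "b \<ge> 0"
    using nonneg[of 1 0] nonneg[of 0 1] by simp_all
  have *: "Poly_Mapping.single (\<gamma> + \<gamma>) c \<in> sos d" if "mdeg \<gamma> = d" "c \<ge> 0" for \<gamma> and c :: real
    by (rule even_single_in_sos) (use that in \<open>auto simp: sum.distrib\<close>)
  show ?thesis
  proof (cases "a = 0")
    case True
    have "k = 0"
    proof (rule ccontr)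
      assume "k \<noteq> 0"
      \<comment> \<open>With \<open>a = 0\<close> the form is linear in \<open>s\<close>; at this
        point its value is -1.\<close>
      then show False
        using nonneg[of "- (b + 1) / k" 1] True by simp
    qed
    then show ?thesis
      using True * assms \<open>b \<ge> 0\<close> by simp
  next
    case False
    with \<open>a \<ge> 0\<close> have a: "a > 0" by simp
    \<comment> \<open>For \<open>t = 1\<close> the minimum over \<open>s\<close> is attained here;
      its value is the coefficient left over after completing the square.\<close>
    have "a * (- k / (2 * a))\<^sup>2 + k * (- k / (2 * a)) * 1 + b * 1\<^sup>2 \<ge> 0"
      by (rule nonneg)
    then have b: "b - k\<^sup>2 / (4 * a) \<ge> 0"
      using a by (simp add: power2_eq_square field_simps)
    have sq: "sqrt a * (sqrt a * 4) = a * 4"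
      using a by (simp add: mult.assoc[symmetric])
    define u where "u = Poly_Mapping.single \<mu> (sqrt a) + Poly_Mapping.single \<nu> (k / (2 * sqrt a))"
    have "u\<^sup>2 = Poly_Mapping.single (\<mu> + \<mu>) a
        + (Poly_Mapping.single (\<mu> + \<nu>) (k / 2) + Poly_Mapping.single (\<mu> + \<nu>) (k / 2))
        + Poly_Mapping.single (\<nu> + \<nu>) (k\<^sup>2 / (4 * a))"
      using a by (simp add: u_def power2_eq_square algebra_simps mult_single sq)
    also have "Poly_Mapping.single (\<mu> + \<nu>) (k / 2) + Poly_Mapping.single (\<mu> + \<nu>) (k / 2)
        = Poly_Mapping.single (\<mu> + \<nu>) k"
      by (simp add: single_add[symmetric])
    finally have eq: "Poly_Mapping.single (\<mu> + \<mu>) a + Poly_Mapping.single (\<mu> + \<nu>) k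
        + Poly_Mapping.single (\<nu> + \<nu>) b
        = u\<^sup>2 + Poly_Mapping.single (\<nu> + \<nu>) (b - k\<^sup>2 / (4 * a))"
      by (simp add: add.assoc single_add[symmetric])
    have "u \<in> forms d"
      unfolding u_def using assms by (intro forms_add single_in_forms)
    then show ?thesis
      unfolding eq using *[OF assms(2) b] by (intro sos_add square_in_sos)
  qed
qed

subsection \<open>Binary forms\<close>

text \<open>The formal degree \<open>k\<close> is independent of \<open>degree p\<close>: a
  polynomial of lower degree gains a power of the variable \<open>j\<close>, and one of higher
  degree is truncated.\<close>

definition binary_homogenize :: "'n \<Rightarrow> 'n \<Rightarrow> nat \<Rightarrow> real poly \<Rightarrow> ('n::finite) mpol" where
  "binary_homogenize i j k p
    = (\<Sum>m\<le>k. Poly_Mapping.single (axis i m + axis j (k - m)) (coeff p m))"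

lemma axis_add: "axis i (a + b) = axis i a + axis i (b :: nat)"
  by (simp add: vec_eq_iff axis_def)

lemma mdeg_axis [simp]: "mdeg (axis i a) = a"
  by (simp add: axis_def)

lemma binary_homogenize_add:
  "binary_homogenize i j k (p + q) = binary_homogenize i j k p + binary_homogenize i j k q"
  by (simp add: binary_homogenize_def single_add sum.distrib)

lemma binary_homogenize_pCons_0:
  "binary_homogenize i j (Suc k) (pCons 0 q)
    = Poly_Mapping.single (axis i 1) 1 * binary_homogenize i j k q"
proof -
  have "axis i (Suc m) + axis j n = axis i 1 + (axis i m + axis j n)" for m n :: nat
    using axis_add[of i 1 m] by (simp add: add.assoc)
  then show ?thesis
    unfolding binary_homogenize_def sum.atMost_Suc_shift
    by (simp add: sum_distrib_left mult_single del: sum.atMost_Suc)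
qed

text \<open>Raising the formal degree by one costs a factor of the variable \<open>j\<close>; the
  degree bound makes the new top coefficient vanish.\<close>

lemma binary_homogenize_Suc_smult:
  assumes "degree q \<le> k"
  shows "binary_homogenize i j (Suc k) (smult c q)
    = Poly_Mapping.single (axis j 1) c * binary_homogenize i j k q"
proof -
  have "axis i m + axis j (Suc k - m) = axis j 1 + (axis i m + axis j (k - m))" if "m \<le> k" for m
    using axis_add[of j 1 "k - m"] that by (simp add: Suc_diff_le add_ac)
  moreover have "coeff q (Suc k) = 0"
    using assms by (simp add: coeff_eq_0)
  ultimately show ?thesis
    unfolding binary_homogenize_def
    by (simp add: sum_distrib_left mult_single)
qed

text \<open>Multiplication by \<open>[:- a, 1:]\<close> is a shift plus a scaling by
  \<open>- a\<close>, and each of the two turns into multiplication by a variable. A root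
  \<open>a\<close> thus becomes the linear form \<open>x_i - a x_j\<close>.\<close>

lemma binary_homogenize_linear_mult:
  assumes "degree q \<le> k"
  shows "binary_homogenize i j (Suc k) ([:- a, 1:] * q)
    = (Poly_Mapping.single (axis i 1) 1 + Poly_Mapping.single (axis j 1) (- a)) * binary_homogenize i j k q"
proof -
  have "[:- a, 1:] * q = smult (- a) q + pCons 0 q"
    by simp
  then show ?thesis
    using assms by (simp only: binary_homogenize_add binary_homogenize_pCons_0
        binary_homogenize_Suc_smult distrib_right add.commute)
qed

section \<open>Nonnegative univariate polynomials\<close>

lemma poly_unbounded_right:
  fixes p :: "real poly"
  assumes "degree p > 0" "lead_coeff p > 0"
  shows "\<exists>n. \<forall>x\<ge>n. poly p x > c"
proof -
  \<comment> \<open>Positive degree ensures that subtracting a constant keeps the leading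
    coefficient, which eventually bounds the polynomial from below.\<close>
  have "lead_coeff (p - [:c:]) = lead_coeff p"
    using assms(1) by (metis degree_pCons_0 lead_coeff_add_le uminus_add_conv_diff degree_minus)
  then obtain n where "\<forall>x\<ge>n. poly (p - [:c:]) x \<ge> lead_coeff p"
    using poly_pinfty_gt_lc[of "p - [:c:]"] assms by auto
  then show ?thesis
    using assms(2) by (intro exI[of _ n]) fastforce
qed

lemma nonneg_poly_lead_coeff:
  fixes p :: "real poly"
  assumes "\<And>x. poly p x \<ge> 0" "degree p > 0"
  shows "lead_coeff p > 0"
proof (rule ccontr)
  assume "\<not> ?thesis"
  then have "lead_coeff (- p) > 0"
    using assms(2) by (metis degree_0 leading_coeff_0_iff lead_coeff_minus less_irrefl linorder_neqE_linordered_idom neg_0_less_iff_less)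
  then obtain n where "\<forall>x\<ge>n. poly (- p) x > 0"
    using poly_unbounded_right[of "- p" 0] assms(2) by auto
  then show False
    using assms(1)[of n] by force
qed

text \<open>Reflection makes the growth bound for large \<open>x\<close> available at the other end
  of the real line.\<close>

lemma poly_reflect:
  fixes p :: "real poly"
  shows "poly (pcompose p [:0, -1:]) x = poly p (- x)"
    "degree (pcompose p [:0, -1:]) = degree p"
    "lead_coeff (pcompose p [:0, -1:]) = (-1) ^ degree p * lead_coeff p"
  using lead_coeff_comp[of "[:0, -1:]" p] by (simp_all add: poly_pcompose degree_pcompose)

text \<open>In odd degree the leading coefficients of \<open>p(x)\<close> and \<open>p(-x)\<close>
  have opposite signs, although both polynomials are nonnegative and therefore need positive
  ones.\<close>

lemma nonneg_poly_even_degree: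
  fixes p :: "real poly"
  assumes "\<And>x. poly p x \<ge> 0"
  shows "even (degree p)"
proof (rule ccontr)
  assume odd: "odd (degree p)"
  then have "degree p > 0" by (simp add: odd_pos)
  then have "lead_coeff p > 0" "lead_coeff (pcompose p [:0, -1:]) > 0"
    using assms nonneg_poly_lead_coeff[of p] nonneg_poly_lead_coeff[of "pcompose p [:0, -1:]"]
    by (auto simp: poly_reflect)
  then show False
    using odd by (simp add: poly_reflect(3) del: lead_coeff_comp)
qed

text \<open>Both ends grow beyond \<open>p(0)\<close>, so the minimum over a compact interval
  containing 0 is global.\<close>

lemma nonneg_poly_attains_min:
  fixes p :: "real poly"
  assumes "\<And>x. poly p x \<ge> 0"
  shows "\<exists>a. \<forall>x. poly p a \<le> poly p x"
proof (cases "degree p = 0")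
  case True
  then show ?thesis by (auto elim!: degree_eq_zeroE)
next
  case False
  then have deg: "degree p > 0" by simp
  then have "lead_coeff p > 0" "lead_coeff (pcompose p [:0, -1:]) > 0"
    using assms nonneg_poly_lead_coeff[of p] nonneg_poly_lead_coeff[of "pcompose p [:0, -1:]"]
    by (auto simp: poly_reflect)
  then obtain n m where n: "\<forall>x\<ge>n. poly p x > poly p 0"
    and m: "\<forall>x\<ge>m. poly (pcompose p [:0, -1:]) x > poly p 0"
    using poly_unbounded_right[of p "poly p 0"] deg
      poly_unbounded_right[of "pcompose p [:0, -1:]" "poly p 0"] by (metis poly_reflect(2))
  define b where "b = \<bar>n\<bar> + \<bar>m\<bar>"
  have "\<exists>a\<in>{-b..b}. \<forall>x\<in>{-b..b}. poly p a \<le> poly p x"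
    by (rule continuous_attains_inf) (auto simp: b_def intro!: continuous_intros)
  then obtain a where a: "\<And>x. x \<in> {-b..b} \<Longrightarrow> poly p a \<le> poly p x"
    by blast
  have "poly p a \<le> poly p x" for x
  proof (cases "x \<in> {-b..b}")
    case False
    then have "x \<ge> n \<or> - x \<ge> m"
      by (auto simp: b_def)
    then have "poly p 0 < poly p x"
      using n m[rule_format, of "- x"] by (auto simp: poly_reflect)
    moreover have "poly p a \<le> poly p 0"
      by (rule a) (auto simp: b_def)
    ultimately show ?thesis by simp
  qed (rule a)
  then show ?thesis by blast
qed

text \<open>A zero is a minimum, so the derivative vanishes there as well and the root is double.
  The cofactor is nonnegative off the root by division and at the root by continuity.\<close>

lemma nonneg_poly_double_root:
  fixes p :: "real poly"
  assumes nonneg: "\<And>x. poly p x \<ge> 0" and root: "poly p a = 0"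
  obtains q where "p = [:- a, 1:] * ([:- a, 1:] * q)" "\<And>x. poly q x \<ge> 0"
proof -
  obtain r where r: "p = [:- a, 1:] * r"
    using root by (auto simp: poly_eq_0_iff_dvd dvd_def)
  have "poly (pderiv p) a = 0"
    using DERIV_local_min[OF poly_DERIV, of 1 a p] nonneg root by simp
  then have "poly r a = 0"
    unfolding r pderiv_mult by (simp add: pderiv_pCons)
  then obtain q where q: "r = [:- a, 1:] * q"
    by (auto simp: poly_eq_0_iff_dvd dvd_def)
  have off: "poly q x \<ge> 0" if "x \<noteq> a" for x
  proof -
    have "poly p x = (x - a)\<^sup>2 * poly q x"
      by (simp add: r q power2_eq_square algebra_simps)
    then show ?thesis
      using nonneg[of x] that by (simp add: zero_le_mult_iff)
  qed
  have "poly q a \<ge> 0"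
  proof (rule tendsto_lowerbound)
    show "((\<lambda>x. poly q x) \<longlongrightarrow> poly q a) (at a)"
      by (auto intro!: tendsto_intros)
    show "\<forall>\<^sub>F x in at a. 0 \<le> poly q x"
      using off by (auto simp: eventually_at_filter)
  qed simp
  with off have "poly q x \<ge> 0" for x by (cases "x = a") auto
  with that r q show ?thesis by blast
qed

text \<open>Each induction step lowers the degree by two. Either the degree of \<open>p\<close> is
  at most \<open>2 * d\<close> and the square of the variable \<open>j\<close> factors out, or the
  minimum is subtracted and its double root yields the square of a linear form.\<close>

lemma binary_homogenize_in_sos:
  fixes i j :: "'n::finite"
  assumes "degree p \<le> 2 * d" "\<And>x. poly p x \<ge> 0"
  shows "binary_homogenize i j (2 * d) p \<in> sos d"
  using assms
proof (induction d arbitrary: p)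
  case 0
  then obtain c where "p = [:c:]"
    by (metis degree_eq_zeroE le_zero_eq mult_0_right)
  then show ?case
    using 0(2)[of 0] even_single_in_sos[of 0 0 c]
    by (simp add: binary_homogenize_def axis_def zero_vec_def[symmetric] vec_eq_iff)
next
  case (Suc d)
  have lin: "Poly_Mapping.single (axis i 1) a + Poly_Mapping.single (axis j 1) b \<in> forms 1"
    for i j :: 'n and a b
    by (intro forms_add single_in_forms) auto
  show ?case
  proof (cases "degree p \<le> 2 * d")
    case True
    have "binary_homogenize i j (Suc (Suc (2 * d))) (smult 1 (smult 1 p))
      = Poly_Mapping.single (axis j 1) 1 * (Poly_Mapping.single (axis j 1) 1 * binary_homogenize i j (2 * d) p)"
      using True by (simp only: binary_homogenize_Suc_smult smult_1_left le_Suc_eq degree_smult_eq)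
        (simp add: binary_homogenize_Suc_smult[of _ _ _ _ 1, simplified])
    then have "binary_homogenize i j (2 * Suc d) p
      = (Poly_Mapping.single (axis j 1) 1)\<^sup>2 * binary_homogenize i j (2 * d) p"
      by (simp add: power2_eq_square mult.assoc)
    moreover have "(Poly_Mapping.single (axis j 1) 1)\<^sup>2 * binary_homogenize i j (2 * d) p \<in> sos (d + 1)"
      by (intro sos_mult_square Suc.IH True Suc.prems single_in_forms) auto
    ultimately show ?thesis by simp
  next
    case False
    have "degree p = 2 * Suc d"
      using False Suc.prems nonneg_poly_even_degree[of p] by (auto elim!: evenE)
    obtain a where a: "\<forall>x. poly p a \<le> poly p x"
      using nonneg_poly_attains_min[of p] Suc.prems(2) by blast
    define m where "m = poly p a"
    have "m \<ge> 0" using Suc.prems(2) by (simp add: m_def)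
    obtain q where q: "p - [:m:] = [:- a, 1:] * ([:- a, 1:] * q)" "\<And>x. poly q x \<ge> 0"
      using nonneg_poly_double_root[of "p - [:m:]" a] a by (auto simp: m_def)
    have p: "p = [:m:] + [:- a, 1:] * ([:- a, 1:] * q)"
      using q(1) by (simp add: algebra_simps)
    have deg: "degree q \<le> 2 * d"
    proof (cases "q = 0")
      case False
      have "degree ([:- a, 1:] * h) = 1 + degree h" "[:- a, 1:] * h \<noteq> 0" if "h \<noteq> 0" for h
        using degree_mult_eq[of "[:- a, 1:]" h] no_zero_divisors[of "[:- a, 1:]" h] that
        by (simp_all del: mult_pCons_left)
      then have "degree ([:- a, 1:] * ([:- a, 1:] * q)) = 2 + degree q"
        using False by (metis add.assoc one_add_one)
      moreover have "degree (p - [:m:]) \<le> 2 * Suc d"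
        using Suc.prems(1) by (intro degree_diff_le) auto
      ultimately show ?thesis using q(1) by simp
    qed simp
    define u :: "'n mpol" where "u = Poly_Mapping.single (axis i 1) 1 + Poly_Mapping.single (axis j 1) (- a)"
    have deg2: "degree ([:- a, 1:] * q) \<le> Suc (2 * d)"
      using deg degree_mult_le[of "[:- a, 1:]" q] by simp
    have "binary_homogenize i j (Suc (Suc (2 * d))) ([:- a, 1:] * ([:- a, 1:] * q))
        = u * (u * binary_homogenize i j (2 * d) q)"
      unfolding u_def using deg deg2 by (simp only: binary_homogenize_linear_mult)
    then have "binary_homogenize i j (2 * Suc d) p
        = binary_homogenize i j (2 * Suc d) [:m:] + u\<^sup>2 * binary_homogenize i j (2 * d) q"
      by (subst p) (simp only: binary_homogenize_add power2_eq_square mult.assoc mult_Suc_right add_2_eq_Suc)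
    \<comment> \<open>The subtracted minimum reappears as a nonnegative multiple of an even power of
      the variable \<open>j\<close>.\<close>
    moreover have "binary_homogenize i j (2 * Suc d) [:m:]
        = Poly_Mapping.single (axis j (2 * Suc d)) m"
    proof -
      have "binary_homogenize i j (2 * Suc d) [:m:]
          = (\<Sum>l\<in>{0}. Poly_Mapping.single (axis i l + axis j (2 * Suc d - l)) (coeff [:m:] l))"
        unfolding binary_homogenize_def
        by (rule sum.mono_neutral_right) (auto simp: coeff_pCons split: nat.splits)
      moreover have "axis i 0 = (0 :: nat ^ 'n)"
        by (simp add: axis_def vec_eq_iff)
      ultimately show ?thesis by simp
    qed
    moreover have "Poly_Mapping.single (axis j (2 * Suc d)) m \<in> sos (Suc d)"
      using \<open>m \<ge> 0\<close> by (intro even_single_in_sos mdeg_axis) (auto simp: axis_def)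
    moreover have "u\<^sup>2 * binary_homogenize i j (2 * d) q \<in> sos (d + 1)"
      unfolding u_def by (intro sos_mult_square Suc.IH deg q(2) lin)
    ultimately show ?thesis
      by (simp add: sos_add)
  qed
qed

section \<open>Forms involving two of the variables\<close>

lemma prod_power_support:
  fixes x :: "real ^ ('n::finite)"
  assumes "\<And>l. l \<notin> A \<Longrightarrow> \<alpha> $ l = (0::nat)"
  shows "(\<Prod>i\<in>UNIV. (x $ i) ^ (\<alpha> $ i)) = (\<Prod>i\<in>A. (x $ i) ^ (\<alpha> $ i))"
  using assms by (intro prod.mono_neutral_right) auto

text \<open>Setting the variable \<open>j\<close> to 1 gives a nonnegative univariate polynomial,
  and homogenizing it in degree \<open>2 * d\<close> recovers \<open>f\<close>.\<close>

lemma binary_form_in_sos: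
  fixes f :: "('n::finite) mpol"
  assumes "f \<in> forms (2 * d)" "i \<noteq> j"
    and supp: "\<And>\<alpha> l. \<alpha> \<in> Poly_Mapping.keys f \<Longrightarrow> l \<notin> {i, j} \<Longrightarrow> \<alpha> $ l = 0"
    and nonneg: "\<And>x. mpol_eval f x \<ge> 0"
  shows "f \<in> sos d"
proof -
  define E :: "nat \<Rightarrow> nat ^ 'n" where "E m = axis i m + axis j (2 * d - m)" for m
  have E: "E m $ i = m" "E m $ j = 2 * d - m" "\<And>l. l \<notin> {i, j} \<Longrightarrow> E m $ l = 0" for m
    using assms(2) by (auto simp: E_def axis_def)
  have keys: "Poly_Mapping.keys f \<subseteq> E ` {..2 * d}"
  proof
    fix \<alpha> assume \<alpha>: "\<alpha> \<in> Poly_Mapping.keys f"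
    have "mdeg \<alpha> = (\<Sum>l\<in>{i, j}. \<alpha> $ l)"
      using supp[OF \<alpha>] by (intro sum.mono_neutral_right) auto
    then have "\<alpha> $ i + \<alpha> $ j = 2 * d"
      using assms(1,2) \<alpha> by (simp add: forms_def)
    then have "\<alpha> = E (\<alpha> $ i)" "\<alpha> $ i \<le> 2 * d"
      using supp[OF \<alpha>] assms(2) by (auto simp: E_def axis_def vec_eq_iff)
    then show "\<alpha> \<in> E ` {..2 * d}" by blast
  qed
  have inj: "inj_on E {..2 * d}"
    by (rule inj_on_inverseI[of _ "\<lambda>\<alpha>. \<alpha> $ i"]) (simp add: E)
  define p where "p = (\<Sum>m\<le>2 * d. monom (Poly_Mapping.lookup f (E m)) m)"
  have coeff: "coeff p m = Poly_Mapping.lookup f (E m)" if "m \<le> 2 * d" for m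
    using that by (simp add: p_def coeff_sum)
  have f: "f = (\<Sum>m\<le>2 * d. Poly_Mapping.single (E m) (Poly_Mapping.lookup f (E m)))"
    by (subst poly_mapping_sum_singles[OF _ keys]) (simp_all add: sum.reindex[OF inj])
  have "binary_homogenize i j (2 * d) p
      = (\<Sum>m\<le>2 * d. Poly_Mapping.single (E m) (Poly_Mapping.lookup f (E m)))"
    unfolding binary_homogenize_def using coeff by (intro sum.cong) (auto simp: E_def)
  with f have "f = binary_homogenize i j (2 * d) p" by simp
  moreover have "degree p \<le> 2 * d"
    unfolding p_def by (intro degree_sum_le) (auto intro: degree_monom_le order_trans)
  moreover have "poly p t \<ge> 0" for t
  proof -
    define x :: "real ^ 'n" where "x = axis i t + axis j 1"
    have x: "x $ i = t" "x $ j = 1"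
      using assms(2) by (auto simp: x_def axis_def)
    have "(\<Prod>l\<in>UNIV. (x $ l) ^ (E m $ l)) = t ^ m" for m
      using assms(2) by (subst prod_power_support[of "{i, j}"]) (auto simp: E x)
    then have "mpol_eval f x = poly p t"
      by (subst f) (simp add: mpol_eval_sum mpol_eval_single p_def poly_sum poly_monom)
    then show ?thesis using nonneg[of x] by simp
  qed
  ultimately show ?thesis
    using binary_homogenize_in_sos by metis
qed

text \<open>Setting the remaining variables to zero leaves a nonnegative binary form.\<close>

lemma even_plus_binary_in_sos:
  fixes f :: "('n::finite) mpol"
  assumes "f \<in> forms (2 * d)" "i \<noteq> j"
    and supp: "\<And>\<alpha> l. \<alpha> \<in> inner_supp f \<Longrightarrow> l \<notin> {i, j} \<Longrightarrow> \<alpha> $ l = 0"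
    and nonneg: "\<And>x. mpol_eval f x \<ge> 0"
  shows "f \<in> sos d"
proof -
  define B where "B = {\<alpha> \<in> Poly_Mapping.keys f. \<forall>l. l \<notin> {i, j} \<longrightarrow> \<alpha> $ l = 0}"
  have B: "finite B" "B \<subseteq> Poly_Mapping.keys f" by (auto simp: B_def)
  define g where "g = (\<Sum>\<alpha>\<in>B. Poly_Mapping.single \<alpha> (Poly_Mapping.lookup f \<alpha>))"
  define h where "h = (\<Sum>\<alpha>\<in>Poly_Mapping.keys f - B. Poly_Mapping.single \<alpha> (Poly_Mapping.lookup f \<alpha>))"
  have "f = (\<Sum>\<alpha>\<in>Poly_Mapping.keys f. Poly_Mapping.single \<alpha> (Poly_Mapping.lookup f \<alpha>))"
    by (rule poly_mapping_sum_singles) auto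
  also have "\<dots> = g + h"
    unfolding g_def h_def by (subst sum.subset_diff[OF B(2)]) (auto simp: add.commute)
  finally have f: "f = g + h" .
  have deg: "mdeg \<alpha> = 2 * d" if "\<alpha> \<in> Poly_Mapping.keys f" for \<alpha>
    using assms(1) that by (simp add: forms_def)
  have "h \<in> sos d"
    unfolding h_def
  proof (rule sos_sum)
    \<comment> \<open>Outside \<open>B\<close> some variable other than \<open>i\<close> and
      \<open>j\<close> occurs, so the exponent is not an inner one.\<close>
    fix \<alpha> assume \<alpha>: "\<alpha> \<in> Poly_Mapping.keys f - B"
    then have "\<alpha> \<in> square_supp f"
      using supp[of \<alpha>] unfolding B_def inner_supp_def by blast
    then show "Poly_Mapping.single \<alpha> (Poly_Mapping.lookup f \<alpha>) \<in> sos d"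
      using \<alpha> deg by (intro even_single_in_sos) (auto simp: square_supp_def)
  qed
  moreover have "g \<in> sos d"
  proof (rule binary_form_in_sos[OF _ assms(2)])
    show "g \<in> forms (2 * d)"
      unfolding g_def using B deg by (intro forms_sum single_in_forms) auto
    have "Poly_Mapping.lookup g \<alpha> = (\<Sum>\<beta>\<in>B. if \<beta> = \<alpha> then Poly_Mapping.lookup f \<alpha> else 0)" for \<alpha>
      unfolding g_def lookup_sum by (intro sum.cong) (auto simp: lookup_single when_def)
    then have "Poly_Mapping.keys g \<subseteq> B"
      using B by (auto simp: in_keys_iff sum.delta split: if_splits)
    then show "\<alpha> $ l = 0" if "\<alpha> \<in> Poly_Mapping.keys g" "l \<notin> {i, j}" for \<alpha> l
      using that by (auto simp: B_def)
    show "mpol_eval g x \<ge> 0" for x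
    proof -
      define y where "y = (\<chi> l. if l \<in> {i, j} then x $ l else 0)"
      have h0: "mpol_eval h y = 0"
        unfolding h_def mpol_eval_sum mpol_eval_single
        by (intro sum.neutral ballI) (auto simp: B_def y_def)
      have yx: "y $ i = x $ i" "y $ j = x $ j"
        by (simp_all add: y_def)
      have "mpol_eval g y = mpol_eval g x"
        unfolding g_def mpol_eval_sum mpol_eval_single
      proof (intro sum.cong refl)
        fix \<alpha> assume "\<alpha> \<in> B"
        then have "(\<Prod>l\<in>UNIV. (v $ l) ^ (\<alpha> $ l)) = (\<Prod>l\<in>{i, j}. (v $ l) ^ (\<alpha> $ l))" for v :: "real ^ 'n"
          by (intro prod_power_support) (auto simp: B_def)
        then show "Poly_Mapping.lookup f \<alpha> * (\<Prod>l\<in>UNIV. (y $ l) ^ (\<alpha> $ l))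
            = Poly_Mapping.lookup f \<alpha> * (\<Prod>l\<in>UNIV. (x $ l) ^ (\<alpha> $ l))"
          using assms(2) yx by simp
      qed
      then have "mpol_eval f y = mpol_eval g x"
        by (simp add: f mpol_eval_add h0)
      then show ?thesis using nonneg[of y] by simp
    qed
  qed
  ultimately show ?thesis
    unfolding f by (intro sos_add)
qed

subsection \<open>Ternary quartic circuits\<close>

definition ternary_exponent :: "'n \<Rightarrow> 'n \<Rightarrow> 'n \<Rightarrow> nat \<Rightarrow> nat \<Rightarrow> nat \<Rightarrow> nat ^ ('n::finite)" where
  "ternary_exponent x y z a b c = axis x a + axis y b + axis z c"

lemma ternary_exponent_add:
  "ternary_exponent x y z a b c + ternary_exponent x y z a' b' c'
    = ternary_exponent x y z (a + a') (b + b') (c + c')"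
  by (simp add: ternary_exponent_def axis_add add_ac)

lemma mdeg_ternary_exponent: "mdeg (ternary_exponent x y z a b c) = a + b + c"
  by (simp add: ternary_exponent_def sum.distrib)

lemma ternary_exponent_nth:
  assumes "distinct [x, y, z]"
  shows "ternary_exponent x y z a b c $ x = a" "ternary_exponent x y z a b c $ y = b"
    "ternary_exponent x y z a b c $ z = c"
    "l \<notin> {x, y, z} \<Longrightarrow> ternary_exponent x y z a b c $ l = 0"
  using assms by (auto simp: ternary_exponent_def axis_def)

lemma mpol_eval_ternary:
  assumes "distinct [x, y, z]"
  shows "mpol_eval (Poly_Mapping.single (ternary_exponent x y z a b c) r) v
    = r * ((v $ x) ^ a * (v $ y) ^ b * (v $ z) ^ c)"
  unfolding mpol_eval_single
  using assms by (subst prod_power_support[of "{x, y, z}"]) (auto simp: ternary_exponent_nth)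

text \<open>Isolates the part of a quartic that survives when a substituted parameter tends to 0;
  the substitutions below leave remainders in \<open>w^2\<close> and \<open>w^4\<close>
  only.\<close>

lemma nonneg_limit_at_0:
  fixes A B C :: real
  assumes "\<And>w. w \<noteq> 0 \<Longrightarrow> A + B * w\<^sup>2 + C * w ^ 4 \<ge> 0"
  shows "A \<ge> 0"
proof (rule tendsto_lowerbound)
  show "((\<lambda>w. A + B * w\<^sup>2 + C * w ^ 4) \<longlongrightarrow> A) (at 0)"
    by (rule tendsto_eq_intros refl | simp)+
  show "\<forall>\<^sub>F w in at 0. 0 \<le> A + B * w\<^sup>2 + C * w ^ 4"
    using assms by (auto simp: eventually_at_filter)
qed simp

lemma sqrt_power4: "s \<ge> 0 \<Longrightarrow> sqrt s ^ 4 = s\<^sup>2"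
  using power_mult[of "sqrt s" 2 2] by simp

text \<open>In the applications \<open>s\<close> is the square of a variable, so only positive
  values are directly available. The form takes the same value at \<open>(s, t)\<close> and
  \<open>(- s, - t)\<close>, and \<open>w \<ge> 0\<close> covers \<open>s = 0\<close>.\<close>

lemma quadratic_nonneg_from_pos:
  fixes u v w s t :: real
  assumes pos: "\<And>s t. s > 0 \<Longrightarrow> u * s\<^sup>2 + v * s * t + w * t\<^sup>2 \<ge> 0" and "w \<ge> 0"
  shows "u * s\<^sup>2 + v * s * t + w * t\<^sup>2 \<ge> 0"
proof -
  consider "s > 0" | "s = 0" | "- s > 0" by linarith
  then show ?thesis
  proof cases
    case 3
    from pos[OF this, of "- t"] show ?thesis by simp
  qed (use pos \<open>w \<ge> 0\<close> in auto)
qed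

lemma ternary_monomial_quadratic_in_sos:
  assumes "i + j + l = d" "i' + j' + l' = d" "\<And>s t. u * s\<^sup>2 + v * s * t + w * t\<^sup>2 \<ge> 0"
  shows "Poly_Mapping.single (ternary_exponent x y z (i + i) (j + j) (l + l)) u
    + Poly_Mapping.single (ternary_exponent x y z (i + i') (j + j') (l + l')) v
    + Poly_Mapping.single (ternary_exponent x y z (i' + i') (j' + j') (l' + l')) w \<in> sos d"
  using monomial_quadratic_in_sos[of "ternary_exponent x y z i j l" d "ternary_exponent x y z i' j' l'" u v w] assms
  by (simp add: mdeg_ternary_exponent ternary_exponent_add)

text \<open>The square of \<open>x z + (k / (2 q)) x y\<close>, weighted by \<open>q\<close>,
  absorbs the inner term \<open>x^2 y z\<close> at the cost of \<open>e x^2 y^2\<close>. The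
  remainder \<open>a x^4 - e x^2 y^2 + b y^4\<close> is the minimum of the quartic over
  \<open>z\<close>, which makes it a nonnegative quadratic form in \<open>x^2\<close> and
  \<open>y^2\<close>.\<close>

lemma ternary_quartic_mixed_in_sos:
  fixes a b q k :: real and x y z :: "'n::finite"
  defines "M \<equiv> \<lambda>i j l. Poly_Mapping.single (ternary_exponent x y z i j l)"
  assumes nonneg: "\<And>X Y Z. a * X ^ 4 + b * Y ^ 4 + q * X\<^sup>2 * Z\<^sup>2 + k * X\<^sup>2 * Y * Z \<ge> 0"
    and "b \<ge> 0" "q > 0"
  shows "M 4 0 0 a + M 0 4 0 b + M 2 0 2 q + M 2 1 1 k \<in> sos 2"
proof -
  define e where "e = k\<^sup>2 / (4 * q)"
  have "(M 2 0 2 q + M 2 1 1 k + M 2 2 0 e) + (M 4 0 0 a + M 2 2 0 (- e) + M 0 4 0 b) \<in> sos 2"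
  proof (rule sos_add)
    have "q * s\<^sup>2 + k * s * t + e * t\<^sup>2 = q * (s + k / (2 * q) * t)\<^sup>2" for s t
      using \<open>q > 0\<close> by (simp add: e_def power2_eq_square field_simps)
    then show "M 2 0 2 q + M 2 1 1 k + M 2 2 0 e \<in> sos 2"
      using ternary_monomial_quadratic_in_sos[of 1 0 1 2 1 1 0 q k e x y z] \<open>q > 0\<close> by (simp add: M_def del: One_nat_def add_2_eq_Suc add_2_eq_Suc')
    have "a * s\<^sup>2 + (- e) * s * t + b * t\<^sup>2 \<ge> 0" for s t
    proof (rule quadratic_nonneg_from_pos)
      show "b \<ge> 0" by fact
      fix s t :: real assume "s > 0"
      show "a * s\<^sup>2 + (- e) * s * t + b * t\<^sup>2 \<ge> 0"
      \<comment> \<open>A nonnegative \<open>t\<close> is a square \<open>Y^2\<close>, and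
        \<open>Z = - k Y / (2 q)\<close> minimizes the quartic in \<open>Z\<close>. For negative
        \<open>t\<close> the middle term is itself nonnegative.\<close>
      proof (cases "t \<ge> 0")
        case True
        have "0 \<le> a * s\<^sup>2 + b * t\<^sup>2 + (q * s * (k / (2 * q) * sqrt t)\<^sup>2 - k * s * sqrt t * (k / (2 * q) * sqrt t))"
          using nonneg[of "sqrt s" "sqrt t" "- (k / (2 * q) * sqrt t)"] \<open>q > 0\<close> \<open>s > 0\<close> True by (simp add: sqrt_power4 algebra_simps)
        also have "q * s * (k / (2 * q) * sqrt t)\<^sup>2 - k * s * sqrt t * (k / (2 * q) * sqrt t) = (- e) * s * t"
          using \<open>q > 0\<close> True by (simp add: e_def power2_eq_square field_simps)
        finally show ?thesis by simp
      next
        case False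
        moreover have "e \<ge> 0" using \<open>q > 0\<close> by (simp add: e_def)
        ultimately have "(- e) * s * t \<ge> 0"
          using \<open>s > 0\<close> by (simp add: mult_nonneg_nonpos)
        moreover have "a * s\<^sup>2 \<ge> 0" "b * t\<^sup>2 \<ge> 0"
          using nonneg[of 1 0 0] \<open>b \<ge> 0\<close> by simp_all
        ultimately show ?thesis by linarith
      qed
    qed
    then show "M 4 0 0 a + M 2 2 0 (- e) + M 0 4 0 b \<in> sos 2"
      using ternary_monomial_quadratic_in_sos[of 2 0 0 2 0 2 0 a "- e" b x y z] by (simp add: M_def del: One_nat_def add_2_eq_Suc add_2_eq_Suc')
  qed
  then show ?thesis
    by (simp add: M_def algebra_simps single_add[symmetric])
qed

text \<open>
  The disjunction on the coefficients is the consequence used here of at most three of the six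
  coefficients of even monomials being nonzero.
\<close>

lemma ternary_quartic_in_sos:
  fixes a b c p q r k :: real and x y z :: "'n::finite"
  defines "M \<equiv> \<lambda>i j l. Poly_Mapping.single (ternary_exponent x y z i j l)"
  assumes nonneg: "\<And>X Y Z. a * X ^ 4 + b * Y ^ 4 + c * Z ^ 4 + p * X\<^sup>2 * Y\<^sup>2 + q * X\<^sup>2 * Z\<^sup>2
      + r * Y\<^sup>2 * Z\<^sup>2 + k * X\<^sup>2 * Y * Z \<ge> 0"
    and coeffs: "a \<ge> 0" "b \<ge> 0" "c \<ge> 0" "p \<ge> 0" "q \<ge> 0" "r \<ge> 0"
    and card: "a = 0 \<or> (b = 0 \<and> c = 0 \<and> r = 0) \<or> (b = 0 \<and> p = 0) \<or> (c = 0 \<and> q = 0)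
      \<or> (p = 0 \<and> q = 0 \<and> r = 0) \<or> (p = 0 \<and> c = 0 \<and> r = 0) \<or> (b = 0 \<and> q = 0 \<and> r = 0)"
  shows "M 4 0 0 a + M 0 4 0 b + M 0 0 4 c + M 2 2 0 p + M 2 0 2 q + M 0 2 2 r + M 2 1 1 k \<in> sos 2"
    (is "?f \<in> _")
proof -
  have even: "M i j l u \<in> sos 2" if "even i" "even j" "even l" "i + j + l = 4" "u \<ge> 0" for i j l u
    unfolding M_def using that
    by (intro even_single_in_sos, unfold mdeg_ternary_exponent) (auto simp: ternary_exponent_def axis_def)
  have quad: "M (i + i) (j + j) (l + l) u + M (i + i') (j + j') (l + l') v + M (i' + i') (j' + j') (l' + l') w \<in> sos 2"
    if "i + j + l = 2" "i' + j' + l' = 2" "\<And>s t. u * s\<^sup>2 + v * s * t + w * t\<^sup>2 \<ge> 0"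
    for i j l i' j' l' u v w
    using ternary_monomial_quadratic_in_sos[OF that] by (simp add: M_def)
  \<comment> \<open>Here the inner monomial \<open>x^2 y z\<close> is read as the product of
    \<open>x y\<close> and \<open>x z\<close>.\<close>
  have xy_xz: ?thesis if "\<And>s t. p * s\<^sup>2 + k * s * t + q * t\<^sup>2 \<ge> 0"
  proof -
    have "(M 2 2 0 p + M 2 1 1 k + M 2 0 2 q)
        + (M 4 0 0 a + M 0 4 0 b + M 0 0 4 c + M 0 2 2 r) \<in> sos 2"
    proof (rule sos_add)
      show "M 2 2 0 p + M 2 1 1 k + M 2 0 2 q \<in> sos 2"
        using quad[of 1 1 0 1 0 1 p k q] that by (simp del: One_nat_def add_2_eq_Suc add_2_eq_Suc')
    qed (intro sos_add even; simp add: coeffs)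
    then show ?thesis by (simp add: add_ac)
  qed
  \<comment> \<open>Here it is read as the product of \<open>x^2\<close> and \<open>y z\<close>; the
    value of \<open>x^2\<close> is never negative, so positive \<open>s\<close> are enough.\<close>
  have xx_yz: ?thesis if "\<And>s t. s > 0 \<Longrightarrow> a * s\<^sup>2 + k * s * t + r * t\<^sup>2 \<ge> 0"
  proof -
    have "(M 4 0 0 a + M 2 1 1 k + M 0 2 2 r)
        + (M 0 4 0 b + M 0 0 4 c + M 2 2 0 p + M 2 0 2 q) \<in> sos 2"
    proof (rule sos_add)
      show "M 4 0 0 a + M 2 1 1 k + M 0 2 2 r \<in> sos 2"
        using quad[of 2 0 0 0 1 1 a k r] quadratic_nonneg_from_pos[OF that] coeffs
        by (simp del: One_nat_def add_2_eq_Suc add_2_eq_Suc')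
    qed (intro sos_add even; simp add: coeffs)
    then show ?thesis by (simp add: add_ac)
  qed
  \<comment> \<open>The strict inequalities in the last three cases lose nothing: if one of these
    coefficients vanishes as well, case 3 or 4 applies.\<close>
  from card consider
      "a = 0" | "b = 0" "c = 0" "r = 0" | "b = 0" "p = 0" | "c = 0" "q = 0"
    | "p = 0" "q = 0" "r = 0" "b > 0" "c > 0" | "p = 0" "c = 0" "r = 0" "q > 0" | "b = 0" "q = 0" "r = 0" "p > 0"
    using coeffs by fastforce
  then show ?thesis
  proof cases
    case 1
    show ?thesis
    proof (rule xy_xz)
      fix s t
      show "p * s\<^sup>2 + k * s * t + q * t\<^sup>2 \<ge> 0"
      proof (rule nonneg_limit_at_0)
        \<comment> \<open>Without an \<open>x^4\<close> term, letting \<open>X = 1 / w\<close> grow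
          isolates the terms of degree 2 in \<open>X\<close>.\<close>
        fix w :: real assume "w \<noteq> 0"
        have "0 \<le> w\<^sup>2 * (b * s ^ 4 + c * t ^ 4 + p * (1 / w)\<^sup>2 * s\<^sup>2 + q * (1 / w)\<^sup>2 * t\<^sup>2
            + r * s\<^sup>2 * t\<^sup>2 + k * (1 / w)\<^sup>2 * s * t)"
          using nonneg[of "1 / w" s t] 1 by simp
        also have "\<dots> = p * s\<^sup>2 + k * s * t + q * t\<^sup>2
            + (b * s ^ 4 + c * t ^ 4 + r * s\<^sup>2 * t\<^sup>2) * w\<^sup>2 + 0 * w ^ 4"
          using \<open>w \<noteq> 0\<close> by (simp add: field_simps)
        finally show "0 \<le> \<dots>" .
      qed
    qed
  next
    case 2
    show ?thesis
    proof (rule xy_xz)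
      fix s t
      show "p * s\<^sup>2 + k * s * t + q * t\<^sup>2 \<ge> 0"
      proof (rule nonneg_limit_at_0)
        \<comment> \<open>Every remaining term contains \<open>X^2\<close>, so \<open>w^2\<close>
          can be divided out before \<open>X = w\<close> tends to 0.\<close>
        fix w :: real assume "w \<noteq> 0"
        have "0 \<le> w\<^sup>2 * (p * s\<^sup>2 + k * s * t + q * t\<^sup>2 + a * w\<^sup>2 + 0 * w ^ 4)"
          using nonneg[of w s t] 2 by (simp add: algebra_simps power2_eq_square power4_eq_xxxx)
        then show "0 \<le> p * s\<^sup>2 + k * s * t + q * t\<^sup>2 + a * w\<^sup>2 + 0 * w ^ 4"
          using \<open>w \<noteq> 0\<close> by (simp add: zero_le_mult_iff)
      qed
    qed
  next
    case 3
    show ?thesis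
    proof (rule xx_yz)
      fix s t :: real assume "s > 0"
      show "a * s\<^sup>2 + k * s * t + r * t\<^sup>2 \<ge> 0"
      proof (rule nonneg_limit_at_0)
        \<comment> \<open>The product \<open>Y Z = t\<close> stays fixed while \<open>Z = w\<close>
          tends to 0; the terms in \<open>y^4\<close> and \<open>x^2 y^2\<close>, which could blow
          up, are absent.\<close>
        fix w :: real assume "w \<noteq> 0"
        show "0 \<le> a * s\<^sup>2 + k * s * t + r * t\<^sup>2 + (q * s) * w\<^sup>2 + c * w ^ 4"
          using nonneg[of "sqrt s" "t / w" w] 3 \<open>s > 0\<close> \<open>w \<noteq> 0\<close>
          by (simp add: sqrt_power4 power_divide algebra_simps)
      qed
    qed
  next
    case 4
    show ?thesis
    proof (rule xx_yz)
      fix s t :: real assume "s > 0"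
      show "a * s\<^sup>2 + k * s * t + r * t\<^sup>2 \<ge> 0"
      proof (rule nonneg_limit_at_0)
        fix w :: real assume "w \<noteq> 0"
        show "0 \<le> a * s\<^sup>2 + k * s * t + r * t\<^sup>2 + (p * s) * w\<^sup>2 + b * w ^ 4"
          using nonneg[of "sqrt s" w "t / w"] 4 \<open>s > 0\<close> \<open>w \<noteq> 0\<close>
          by (simp add: sqrt_power4 power_divide algebra_simps)
      qed
    qed
  next
    case 5
    note bc = \<open>b > 0\<close> \<open>c > 0\<close>
    \<comment> \<open>For fixed \<open>Y Z = t\<close> the least value of
      \<open>b Y^4 + c Z^4\<close> is \<open>2 u t^2\<close>, attained where the two terms are
      equal. Adding and subtracting \<open>2 u y^2 z^2\<close> thus leaves a nonnegative form in
      \<open>x^2\<close> and \<open>y z\<close> and the square of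
      \<open>sqrt b y^2 - sqrt c z^2\<close>.\<close>
    define u where "u = sqrt b * sqrt c"
    have "(M 4 0 0 a + M 2 1 1 k + M 0 2 2 (2 * u)) + (M 0 4 0 b + M 0 2 2 (- 2 * u) + M 0 0 4 c) \<in> sos 2"
    proof (rule sos_add)
      have "a * s\<^sup>2 + k * s * t + 2 * u * t\<^sup>2 \<ge> 0" for s t
      proof (rule quadratic_nonneg_from_pos)
        show "2 * u \<ge> 0" using bc by (simp add: u_def)
        fix s t :: real assume "s > 0"
        define h g where "h = sqrt (sqrt b)" and "g = sqrt (sqrt c)"
        have hg: "h > 0" "g > 0" "b = h ^ 4" "c = g ^ 4" "u = h\<^sup>2 * g\<^sup>2"
          using bc by (simp_all add: h_def g_def u_def sqrt_power4)
        define Y Z where "Y = sgn t * sqrt (\<bar>t\<bar> * (g / h))" and "Z = sqrt (\<bar>t\<bar> * (h / g))"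
        have "sqrt (\<bar>t\<bar> * (g / h)) * Z = \<bar>t\<bar>"
          using hg by (simp add: Z_def real_sqrt_mult[symmetric])
        then have "Y * Z = t"
          by (simp add: Y_def mult.assoc sgn_mult_abs)
        moreover have "Y ^ 4 = (t * (g / h))\<^sup>2" "Z ^ 4 = (t * (h / g))\<^sup>2"
          using hg(1,2) by (simp_all add: Y_def Z_def power_mult_distrib power_divide sqrt_power4 sgn_if)
        then have "b * Y ^ 4 = u * t\<^sup>2" "c * Z ^ 4 = u * t\<^sup>2"
          using hg(1,2) unfolding hg(3-5) by (simp_all add: power2_eq_square power4_eq_xxxx field_simps)
        ultimately have YZ: "Y * Z = t" "b * Y ^ 4 = u * t\<^sup>2" "c * Z ^ 4 = u * t\<^sup>2"
          by auto
        show "a * s\<^sup>2 + k * s * t + 2 * u * t\<^sup>2 \<ge> 0"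
          using nonneg[of "sqrt s" Y Z] 5 \<open>s > 0\<close> YZ by (simp add: sqrt_power4 mult.assoc)
      qed
      then show "M 4 0 0 a + M 2 1 1 k + M 0 2 2 (2 * u) \<in> sos 2"
        using quad[of 2 0 0 0 1 1 a k "2 * u"] by (simp del: One_nat_def add_2_eq_Suc add_2_eq_Suc')
      have "b * s\<^sup>2 + (- 2 * u) * s * t + c * t\<^sup>2 = (sqrt b * s - sqrt c * t)\<^sup>2" for s t
        using bc by (simp add: u_def power2_eq_square algebra_simps)
      then show "M 0 4 0 b + M 0 2 2 (- 2 * u) + M 0 0 4 c \<in> sos 2"
        using quad[of 0 2 0 0 0 2 b "- 2 * u" c] by (simp del: One_nat_def add_2_eq_Suc add_2_eq_Suc')
    qed
    moreover have "M 0 2 2 (2 * u) + M 0 2 2 (- 2 * u) = 0"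
      by (simp add: M_def single_add[symmetric])
    ultimately show ?thesis
      using 5 by (simp add: M_def algebra_simps single_add[symmetric])
  next
    case 6
    have "M 4 0 0 a + M 0 4 0 b + M 2 0 2 q + M 2 1 1 k \<in> sos 2"
      unfolding M_def by (intro ternary_quartic_mixed_in_sos coeffs) (use nonneg 6 in simp_all)
    then show ?thesis
      using 6 by (simp add: M_def)
  next
    case 7
    \<comment> \<open>The preceding case with \<open>y\<close> and \<open>z\<close>
      exchanged.\<close>
    have swap: "ternary_exponent x z y i l j = ternary_exponent x y z i j l" for i j l
      by (simp add: ternary_exponent_def add_ac)
    have "Poly_Mapping.single (ternary_exponent x z y 4 0 0) a + Poly_Mapping.single (ternary_exponent x z y 0 4 0) c
      + Poly_Mapping.single (ternary_exponent x z y 2 0 2) p + Poly_Mapping.single (ternary_exponent x z y 2 1 1) k \<in> sos 2"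
    proof (intro ternary_quartic_mixed_in_sos coeffs)
      show "a * X ^ 4 + c * Y ^ 4 + p * X\<^sup>2 * Z\<^sup>2 + k * X\<^sup>2 * Y * Z \<ge> 0" for X Y Z
        using nonneg[of X Z Y] 7 by (simp add: mult_ac)
    qed fact
    then show ?thesis
      using 7 by (simp add: M_def swap)
  qed
qed

subsection \<open>Circuits in the Hilbert cases\<close>

lemma inj_real_vec: "inj (real_vec :: nat ^ ('n::finite) \<Rightarrow> _)"
  by (auto simp: inj_on_def real_vec_def vec_eq_iff)

lemma keys_eq_square_inner: "Poly_Mapping.keys f = square_supp f \<union> inner_supp f"
  by (auto simp: square_supp_def inner_supp_def)

text \<open>Exponents of degree \<open>k\<close> lie in an affine hyperplane, whose dimension
  \<open>CARD('n) - 1\<close> bounds the size of an affinely independent set.\<close>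

lemma card_square_supp_le:
  fixes f :: "('n::finite) mpol"
  assumes "circuit f" "f \<in> forms k"
  shows "card (square_supp f) \<le> CARD('n)"
proof -
  let ?V = "real_vec ` square_supp f" and ?H = "{v. (\<chi> i. 1) \<bullet> v = real k} :: (real ^ 'n) set"
  have "\<not> affine_dependent ?V"
    using assms(1) by (simp add: circuit_def)
  then have "int (card ?V) = aff_dim ?V + 1"
    by (rule aff_dim_affine_independent)
  also have "?V \<subseteq> ?H"
  proof
    fix v assume "v \<in> ?V"
    then obtain \<alpha> where "\<alpha> \<in> square_supp f" "v = real_vec \<alpha>" by blast
    moreover from this have "mdeg \<alpha> = k"
      using assms(2) by (auto simp: square_supp_def forms_def)
    ultimately show "v \<in> ?H"
      by (auto simp: inner_vec_def real_vec_def)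
  qed
  then have "aff_dim ?V + 1 \<le> aff_dim ?H + 1 "
    by (simp add: aff_dim_subset)
  also have "\<dots> = int CARD('n)"
    by (subst aff_dim_hyperplane) (auto simp: vec_eq_iff)
  finally show ?thesis
    using card_image[OF inj_on_subset[OF inj_real_vec subset_UNIV], of "square_supp f"] by simp
qed

lemma all_even_in_sos:
  assumes "f \<in> forms (2 * d)" "inner_supp f = {}"
  shows "f \<in> sos d"
proof -
  have "(\<Sum>\<alpha>\<in>Poly_Mapping.keys f. Poly_Mapping.single \<alpha> (Poly_Mapping.lookup f \<alpha>)) \<in> sos d"
    using assms
    by (intro sos_sum even_single_in_sos) (auto simp: forms_def inner_supp_def square_supp_def)
  then show ?thesis
    using poly_mapping_sum_singles[of "Poly_Mapping.keys f" f] by simp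
qed

text \<open>The six even exponents of degree 4 and the inner exponent (2, 1, 1) exhaust the possible
  support, which gives the normal form treated in \<open>ternary_quartic_in_sos\<close>.\<close>

lemma ternary_quartic_circuit_in_sos:
  fixes f :: "('n::finite) mpol"
  assumes f: "f \<in> forms 4" "nonneg_circuit f"
    and xyz: "distinct [x, y, z]" "UNIV = {x, y, z :: 'n}"
    and inner: "inner_supp f = {\<beta>}" "\<beta> $ x = 2" "\<beta> $ y = 1" "\<beta> $ z = 1"
  shows "f \<in> sos 2"
proof -
  let ?E = "ternary_exponent x y z"
  define A where "A = {?E 4 0 0, ?E 0 4 0, ?E 0 0 4, ?E 2 2 0, ?E 2 0 2, ?E 0 2 2}"
  define co where "co i j l = Poly_Mapping.lookup f (?E i j l)" for i j l
  have nth: "?E i j l $ x = i" "?E i j l $ y = j" "?E i j l $ z = l" for i j l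
    using xyz(1) by (simp_all add: ternary_exponent_nth)
  have E_eq: "?E (\<alpha> $ x) (\<alpha> $ y) (\<alpha> $ z) = \<alpha>" for \<alpha>
  proof -
    have "?E (\<alpha> $ x) (\<alpha> $ y) (\<alpha> $ z) $ l = \<alpha> $ l" for l
    proof -
      have "l \<in> {x, y, z}" unfolding xyz(2)[symmetric] by simp
      then show ?thesis by (auto simp: nth)
    qed
    then show ?thesis by (simp add: vec_eq_iff)
  qed
  have inj: "?E i j l = ?E i' j' l' \<longleftrightarrow> i = i' \<and> j = j' \<and> l = l'" for i j l i' j' l'
    by (metis nth)
  have \<beta>: "\<beta> = ?E 2 1 1"
    using E_eq[of \<beta>] inner by simp
  have deg: "\<alpha> $ x + \<alpha> $ y + \<alpha> $ z = 4" if "\<alpha> \<in> Poly_Mapping.keys f" for \<alpha>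
  proof -
    have "mdeg \<alpha> = 4"
      using f(1) that by (simp add: forms_def)
    then show ?thesis
      unfolding xyz(2) using xyz(1) by (simp add: add.assoc)
  qed
  have sq: "square_supp f \<subseteq> A"
  proof
    fix \<alpha> assume "\<alpha> \<in> square_supp f"
    then have \<alpha>: "\<alpha> $ x + \<alpha> $ y + \<alpha> $ z = 4" "even (\<alpha> $ x)" "even (\<alpha> $ y)" "even (\<alpha> $ z)"
      using deg by (auto simp: square_supp_def)
    then obtain i j l where ijl: "\<alpha> $ x = 2 * i" "\<alpha> $ y = 2 * j" "\<alpha> $ z = 2 * l"
      by (auto elim!: evenE)
    with \<alpha>(1) have ijl2: "i + j + l = 2" by simp
    then have "i = 0 \<or> i = 1 \<or> i = 2" "j = 0 \<or> j = 1 \<or> j = 2" by linarith+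
    then have "i = 2 \<and> j = 0 \<and> l = 0 \<or> i = 0 \<and> j = 2 \<and> l = 0 \<or> i = 0 \<and> j = 0 \<and> l = 2
      \<or> i = 1 \<and> j = 1 \<and> l = 0 \<or> i = 1 \<and> j = 0 \<and> l = 1 \<or> i = 0 \<and> j = 1 \<and> l = 1"
      using ijl2 by (elim disjE) simp_all
    then show "\<alpha> \<in> A"
      using E_eq[of \<alpha>] ijl by (auto simp: A_def)
  qed
  \<comment> \<open>A negative coefficient would make the exponent an inner one, but the only inner
    exponent has odd entries.\<close>
  have co_nonneg: "Poly_Mapping.lookup f \<alpha> \<ge> 0" if "\<alpha> \<in> A" for \<alpha>
  proof (rule ccontr)
    assume "\<not> ?thesis"
    then have "\<alpha> \<in> inner_supp f"
      by (auto simp: inner_supp_def square_supp_def in_keys_iff)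
    with inner that \<beta> show False
      by (auto simp: A_def inj)
  qed
  have "Poly_Mapping.keys f \<subseteq> insert \<beta> A"
    using sq inner(1) keys_eq_square_inner[of f] by auto
  then have "f = (\<Sum>\<alpha>\<in>insert \<beta> A. Poly_Mapping.single \<alpha> (Poly_Mapping.lookup f \<alpha>))"
    by (intro poly_mapping_sum_singles) (auto simp: A_def)
  also have "\<dots> = Poly_Mapping.single (?E 4 0 0) (co 4 0 0) + Poly_Mapping.single (?E 0 4 0) (co 0 4 0)
      + Poly_Mapping.single (?E 0 0 4) (co 0 0 4) + Poly_Mapping.single (?E 2 2 0) (co 2 2 0)
      + Poly_Mapping.single (?E 2 0 2) (co 2 0 2) + Poly_Mapping.single (?E 0 2 2) (co 0 2 2)
      + Poly_Mapping.single (?E 2 1 1) (co 2 1 1)"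
    unfolding A_def \<beta> co_def by (simp add: inj add_ac)
  finally have f_eq: "f = \<dots>" .
  \<comment> \<open>At most three of the six coefficients are positive; running through the choices
    gives the disjunction \<open>card\<close>.\<close>
  have "card {\<alpha> \<in> A. Poly_Mapping.lookup f \<alpha> > 0} \<le> card (square_supp f)"
  proof (rule card_mono)
    show "{\<alpha> \<in> A. Poly_Mapping.lookup f \<alpha> > 0} \<subseteq> square_supp f"
    proof
      fix \<alpha> assume \<alpha>: "\<alpha> \<in> {\<alpha> \<in> A. Poly_Mapping.lookup f \<alpha> > 0}"
      then have "\<alpha> \<noteq> \<beta>" by (auto simp: A_def \<beta> inj)
      then show "\<alpha> \<in> square_supp f"
        using \<alpha> inner(1) keys_eq_square_inner[of f] by (auto simp: in_keys_iff)
    qed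
  qed (auto intro: finite_subset[OF sq] simp: A_def)
  also have "\<dots> \<le> CARD('n)"
    using f by (intro card_square_supp_le) (auto simp: nonneg_circuit_def)
  also have "CARD('n) = 3"
    unfolding xyz(2) using xyz(1) by simp
  finally have "(\<Sum>\<alpha>\<in>A. if Poly_Mapping.lookup f \<alpha> > 0 then 1 else 0 :: nat) \<le> 3"
    by (subst sum.inter_filter[symmetric]) (auto simp: A_def)
  then have card: "co 4 0 0 = 0 \<or> (co 0 4 0 = 0 \<and> co 0 0 4 = 0 \<and> co 0 2 2 = 0)
      \<or> (co 0 4 0 = 0 \<and> co 2 2 0 = 0) \<or> (co 0 0 4 = 0 \<and> co 2 0 2 = 0)
      \<or> (co 2 2 0 = 0 \<and> co 2 0 2 = 0 \<and> co 0 2 2 = 0) \<or> (co 2 2 0 = 0 \<and> co 0 0 4 = 0 \<and> co 0 2 2 = 0)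
      \<or> (co 0 4 0 = 0 \<and> co 2 0 2 = 0 \<and> co 0 2 2 = 0)"
    using co_nonneg by (simp add: A_def inj co_def less_le split: if_splits)
  show ?thesis
    unfolding f_eq
  proof (intro ternary_quartic_in_sos card)
    fix X Y Z :: real
    define v :: "real ^ 'n" where "v = axis x X + axis y Y + axis z Z"
    have v: "v $ x = X" "v $ y = Y" "v $ z = Z"
      using xyz(1) by (auto simp: v_def axis_def)
    have "mpol_eval f v \<ge> 0"
      using f(2) by (simp add: nonneg_circuit_def)
    then show "co 4 0 0 * X ^ 4 + co 0 4 0 * Y ^ 4 + co 0 0 4 * Z ^ 4 + co 2 2 0 * X\<^sup>2 * Y\<^sup>2
        + co 2 0 2 * X\<^sup>2 * Z\<^sup>2 + co 0 2 2 * Y\<^sup>2 * Z\<^sup>2 + co 2 1 1 * X\<^sup>2 * Y * Z \<ge> 0"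
      by (subst (asm) f_eq) (simp add: mpol_eval_add mpol_eval_ternary[OF xyz(1)] v mult.assoc)
  qed (use co_nonneg in \<open>auto simp: co_def A_def\<close>)
qed

text \<open>The inner exponent has degree \<open>2 * d\<close>, so it involves at most
  \<open>2 * d\<close> and at most \<open>CARD('n)\<close> variables. In a Hilbert case this exceeds
  two only for ternary quartics, where an exponent involving all three variables is (2, 1, 1) up to
  order.\<close>

lemma nonneg_circuit_in_sos:
  fixes f :: "('n::finite) mpol"
  assumes "hilbert_case CARD('n) (2 * d)" "f \<in> forms (2 * d)" "nonneg_circuit f"
  shows "f \<in> sos d"
proof (cases "inner_supp f = {}")
  case True
  then show ?thesis using assms(2) by (rule all_even_in_sos[rotated])
next
  case False
  then obtain \<beta> where \<beta>: "inner_supp f = {\<beta>}"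
    using assms(3) by (auto simp: nonneg_circuit_def circuit_def)
  have nonneg: "mpol_eval f x \<ge> 0" for x
    using assms(3) by (simp add: nonneg_circuit_def)
  have "\<beta> \<in> Poly_Mapping.keys f"
    using \<beta> by (auto simp: inner_supp_def)
  then have deg: "mdeg \<beta> = 2 * d"
    using assms(2) by (simp add: forms_def)
  define P where "P = {l. \<beta> $ l \<noteq> 0}"
  have two: ?thesis if "card P \<le> 2" "CARD('n) \<ge> 2"
  proof -
    have "\<exists>Q. P \<subseteq> Q \<and> Q \<subseteq> UNIV \<and> card Q = 2"
      using that by (intro exists_subset_between) auto
    then obtain Q where Q: "P \<subseteq> Q" "card Q = 2" by blast
    then obtain i j where "Q = {i, j}" "i \<noteq> j"
      by (auto simp: card_2_iff)
    then show ?thesis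
      using Q(1) \<beta> by (intro even_plus_binary_in_sos[OF assms(2) _ _ nonneg]) (auto simp: P_def)
  qed
  have P_deg: "card P \<le> 2 * d"
  proof -
    have "card P = (\<Sum>l\<in>P. 1)" by simp
    also have "\<dots> \<le> (\<Sum>l\<in>P. \<beta> $ l)" by (rule sum_mono) (auto simp: P_def)
    also have "\<dots> \<le> mdeg \<beta>" by (rule sum_mono2) auto
    finally show ?thesis using deg by simp
  qed
  have P_card: "card P \<le> CARD('n)" by (rule card_mono) auto
  have "CARD('n) > 0" by simp
  then consider "CARD('n) = 1" "d = 1" | "card P \<le> 2" "CARD('n) \<ge> 2" | "CARD('n) = 3" "d = 2" "card P = 3"
    using assms(1) P_deg P_card unfolding hilbert_case_def by linarith
  then show ?thesis
  proof cases
    case 1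
    \<comment> \<open>The only monomial in one variable of degree 2 is the square, and nonnegativity
      makes its coefficient positive. It is not an inner one, so this case is contradictory.\<close>
    then obtain i where i: "UNIV = {i :: 'n}"
      by (auto simp: card_1_singleton_iff)
    have eq: "\<alpha> = \<beta>" if "\<alpha> \<in> Poly_Mapping.keys f" for \<alpha>
    proof -
      have "mdeg \<alpha> = mdeg \<beta>" using that assms(2) deg by (simp add: forms_def)
      then have "\<alpha> $ i = \<beta> $ i" unfolding i by simp
      moreover have "l = i" for l using i by blast
      ultimately show ?thesis by (metis vec_eq_iff)
    qed
    then have "Poly_Mapping.keys f \<subseteq> {\<beta>}" by blast
    then have "mpol_eval f (\<chi> l. 1) = Poly_Mapping.lookup f \<beta>"
      by (subst mpol_eval_superset[of "{\<beta>}"]) auto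
    then have "Poly_Mapping.lookup f \<beta> \<ge> 0" using nonneg by metis
    moreover have "even (\<beta> $ l)" for l
    proof -
      have "l = i" using i by blast
      then show ?thesis using deg unfolding i by simp
    qed
    ultimately have "\<beta> \<in> square_supp f"
      using \<open>\<beta> \<in> Poly_Mapping.keys f\<close> by (auto simp: square_supp_def in_keys_iff)
    then show ?thesis using \<beta> by (auto simp: inner_supp_def)
  next
    case 2
    then show ?thesis by (rule two)
  next
    case 3
    then have "P = UNIV" by (metis card_subset_eq finite subset_UNIV)
    then have pos: "\<beta> $ l > 0" for l by (auto simp: P_def)
    obtain u v w where uvw: "UNIV = {u, v, w :: 'n}" "u \<noteq> v" "v \<noteq> w" "u \<noteq> w"
      using 3(1) by (metis card_3_iff)
    have "\<beta> $ u + \<beta> $ v + \<beta> $ w = 4"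
      using deg uvw(2-4) 3(2) unfolding uvw(1) by (simp add: add.assoc)
    then consider "\<beta> $ u = 2" "\<beta> $ v = 1" "\<beta> $ w = 1" | "\<beta> $ v = 2" "\<beta> $ u = 1" "\<beta> $ w = 1"
      | "\<beta> $ w = 2" "\<beta> $ u = 1" "\<beta> $ v = 1"
      using pos[of u] pos[of v] pos[of w] by linarith
    moreover have "f \<in> forms 4" using assms(2) 3(2) by simp
    note ternary = ternary_quartic_circuit_in_sos[OF this assms(3) _ _ \<beta>]
    have "UNIV = {v, u, w}" "UNIV = {w, u, v}" using uvw(1) by auto
    ultimately have "f \<in> sos 2"
      using ternary[of u v w] ternary[of v u w] ternary[of w u v] uvw by auto
    then show ?thesis using 3(2) by simp
  qed
qed

lemma sonc_subset_sos:
  assumes "hilbert_case CARD('n::finite) (2 * d)"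
  shows "(sonc (2 * d) :: 'n mpol set) \<subseteq> sos d"
  using nonneg_circuit_in_sos[OF assms] by (auto simp: sonc_def intro!: sos_sum)

subsection \<open>Obstructions to membership\<close>

definition parity_sign :: "nat ^ ('n::finite) \<Rightarrow> real" where
  "parity_sign \<alpha> = (if \<forall>i. even (\<alpha> $ i) then 1 else - 1)"

text \<open>The linear functional that separates the witnesses from \<open>sonc\<close>: it is
  nonnegative on every nonnegative circuit and negative on the witnesses.\<close>

definition parity_sum :: "('n::finite) mpol \<Rightarrow> real" where
  "parity_sum f = (\<Sum>\<alpha>\<in>Poly_Mapping.keys f. Poly_Mapping.lookup f \<alpha> * parity_sign \<alpha>)"

lemma parity_sum_superset:
  assumes "finite A" "Poly_Mapping.keys f \<subseteq> A"
  shows "parity_sum f = (\<Sum>\<alpha>\<in>A. Poly_Mapping.lookup f \<alpha> * parity_sign \<alpha>)"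
  unfolding parity_sum_def using assms
  by (intro sum.mono_neutral_left) (auto simp: in_keys_iff)

lemma parity_sum_add: "parity_sum (f + g) = parity_sum f + parity_sum g"
proof -
  let ?A = "Poly_Mapping.keys f \<union> Poly_Mapping.keys g"
  have "Poly_Mapping.keys (f + g) \<subseteq> ?A"
    by (rule keys_add)
  then show ?thesis
    by (simp add: parity_sum_superset[of ?A] lookup_add sum.distrib distrib_right)
qed

lemma parity_sum_single: "parity_sum (Poly_Mapping.single \<alpha> c) = c * parity_sign \<alpha>"
  by (subst parity_sum_superset[of "{\<alpha>}"]) auto

lemma parity_sum_sum: "parity_sum (\<Sum>a\<in>A. f a) = (\<Sum>a\<in>A. parity_sum (f a))"
  by (induction A rule: infinite_finite_induct) (auto simp: parity_sum_add, auto simp: parity_sum_def)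

text \<open>
  A circuit has at most one monomial that is not an even one, so flipping the sign of one
  coordinate of the all-ones vector realizes \<open>parity_sum\<close> as a point evaluation. A sum of
  circuits need not have such a point.
\<close>

lemma parity_sum_nonneg_circuit:
  fixes f :: "('n::finite) mpol"
  assumes "nonneg_circuit f"
  shows "parity_sum f \<ge> 0"
proof -
  have "\<exists>x. mpol_eval f x = parity_sum f"
  proof (cases "\<exists>\<beta> i. inner_supp f = {\<beta>} \<and> odd (\<beta> $ i)")
    case True
    then obtain \<beta> i where \<beta>: "inner_supp f = {\<beta>}" "odd (\<beta> $ i)" by blast
    define x :: "real ^ 'n" where "x = (\<chi> l. if l = i then - 1 else 1)"
    have "(\<Prod>l\<in>UNIV. (x $ l) ^ (\<alpha> $ l)) = (\<Prod>l\<in>{i}. (x $ l) ^ (\<alpha> $ l))" for \<alpha>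
      by (rule prod.mono_neutral_right) (auto simp: x_def)
    then have x: "(\<Prod>l\<in>UNIV. (x $ l) ^ (\<alpha> $ l)) = (if even (\<alpha> $ i) then 1 else - 1)" for \<alpha>
      by (simp add: x_def)
    have "(\<Prod>l\<in>UNIV. (x $ l) ^ (\<alpha> $ l)) = parity_sign \<alpha>" if "\<alpha> \<in> Poly_Mapping.keys f" for \<alpha>
    proof (cases "\<alpha> = \<beta>")
      case False
      then have "\<alpha> \<in> square_supp f"
        using \<beta>(1) that by (auto simp: inner_supp_def)
      then show ?thesis
        unfolding x by (simp add: square_supp_def parity_sign_def)
    qed (use \<beta>(2) in \<open>auto simp: x parity_sign_def\<close>)
    then have "mpol_eval f x = parity_sum f"
      unfolding mpol_eval_def parity_sum_def by (intro sum.cong) auto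
    then show ?thesis ..
  next
    case False
    \<comment> \<open>An inner exponent, if there is one, has only even entries here, so all signs
      are 1 and the all-ones vector serves.\<close>
    have "parity_sign \<alpha> = 1" if "\<alpha> \<in> Poly_Mapping.keys f" for \<alpha>
    proof (cases "\<alpha> \<in> inner_supp f")
      case True
      then have "inner_supp f = {\<alpha>}"
        using assms by (auto simp: nonneg_circuit_def circuit_def)
      then show ?thesis
        using False by (auto simp: parity_sign_def)
    next
      case False
      with that show ?thesis
        by (auto simp: parity_sign_def inner_supp_def square_supp_def)
    qed
    then have "mpol_eval f (\<chi> l. 1) = parity_sum f"
      unfolding mpol_eval_def parity_sum_def by (intro sum.cong) auto
    then show ?thesis ..
  qed
  then show ?thesis
    using assms by (metis nonneg_circuit_def)
qed

lemma parity_sum_sonc: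
  assumes "f \<in> sonc k"
  shows "parity_sum f \<ge> 0"
proof -
  obtain m :: nat and h where "\<forall>j<m. nonneg_circuit (h j)" "f = (\<Sum>j<m. h j)"
    using assms by (auto simp: sonc_def)
  moreover from this(1) have "(\<Sum>j<m. parity_sum (h j)) \<ge> 0"
    by (intro sum_nonneg parity_sum_nonneg_circuit) simp
  ultimately show ?thesis
    by (simp add: parity_sum_sum)
qed

section \<open>Coefficients of squares and Newton polytopes\<close>

lemma square_as_singles:
  "g\<^sup>2 = (\<Sum>\<alpha>\<in>Poly_Mapping.keys g. \<Sum>\<alpha>'\<in>Poly_Mapping.keys g.
      Poly_Mapping.single (\<alpha> + \<alpha>') (Poly_Mapping.lookup g \<alpha> * Poly_Mapping.lookup g \<alpha>'))"
  for g :: "('n::finite) mpol"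
proof -
  have g: "g = (\<Sum>\<alpha>\<in>Poly_Mapping.keys g. Poly_Mapping.single \<alpha> (Poly_Mapping.lookup g \<alpha>))"
    by (rule poly_mapping_sum_singles) auto
  have "g\<^sup>2 = (\<Sum>\<alpha>\<in>Poly_Mapping.keys g. Poly_Mapping.single \<alpha> (Poly_Mapping.lookup g \<alpha>))
      * (\<Sum>\<alpha>\<in>Poly_Mapping.keys g. Poly_Mapping.single \<alpha> (Poly_Mapping.lookup g \<alpha>))"
    unfolding power2_eq_square using g by metis
  then show ?thesis
    by (simp add: sum_product mult_single)
qed

text \<open>If exponents of \<open>g\<close> add up to \<delta> only as doubles, no cross term
  reaches \<delta> and its coefficient is a sum of squares. This is applied at extreme points and at
  the inner exponent of the witness.\<close>

lemma lookup_square_diagonal: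
  fixes g :: "('n::finite) mpol"
  assumes "\<And>\<alpha> \<alpha>'. \<alpha> \<in> Poly_Mapping.keys g \<Longrightarrow> \<alpha>' \<in> Poly_Mapping.keys g \<Longrightarrow> \<alpha> + \<alpha>' = \<delta> \<Longrightarrow> \<alpha> = \<alpha>'"
  shows "Poly_Mapping.lookup (g\<^sup>2) \<delta>
    = (\<Sum>\<alpha>\<in>Poly_Mapping.keys g. if \<alpha> + \<alpha> = \<delta> then (Poly_Mapping.lookup g \<alpha>)\<^sup>2 else 0)"
proof -
  let ?K = "Poly_Mapping.keys g"
  have "Poly_Mapping.lookup (g\<^sup>2) \<delta> = (\<Sum>\<alpha>\<in>?K. \<Sum>\<alpha>'\<in>?K.
      if \<alpha> + \<alpha>' = \<delta> then Poly_Mapping.lookup g \<alpha> * Poly_Mapping.lookup g \<alpha>' else 0)"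
    by (subst square_as_singles) (simp add: lookup_sum lookup_single when_def)
  also have "\<dots> = (\<Sum>\<alpha>\<in>?K. \<Sum>\<alpha>'\<in>?K.
      if \<alpha> = \<alpha>' then if \<alpha> + \<alpha> = \<delta> then (Poly_Mapping.lookup g \<alpha>)\<^sup>2 else 0 else 0)"
    using assms by (intro sum.cong refl) (auto simp: power2_eq_square)
  also have "\<dots> = (\<Sum>\<alpha>\<in>?K. if \<alpha> + \<alpha> = \<delta> then (Poly_Mapping.lookup g \<alpha>)\<^sup>2 else 0)"
    by (intro sum.cong refl) (simp add: sum.delta)
  finally show ?thesis .
qed

text \<open>
  At an extreme point \<open>v\<close> of the hull of all exponents occurring in the summands, the
  coefficient of \<open>2v\<close> in the sum is a sum of squares of coefficients, so it cannot cancel.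
\<close>

lemma sos_summand_newton_polytope:
  fixes g :: "nat \<Rightarrow> ('n::finite) mpol"
  assumes "j < m" "\<gamma> \<in> Poly_Mapping.keys (g j)"
  shows "2 *\<^sub>R real_vec \<gamma> \<in> newton_polytope (\<Sum>j<m. (g j)\<^sup>2)"
proof -
  define f where "f = (\<Sum>j<m. (g j)\<^sup>2)"
  define S where "S = (\<Union>j<m. Poly_Mapping.keys (g j))"
  define K where "K = convex hull (real_vec ` S)"
  have "finite S" by (simp add: S_def)
  have "compact K" "convex K"
    using \<open>finite S\<close> by (simp_all add: K_def finite_imp_compact_convex_hull)
  have ext: "2 *\<^sub>R v \<in> newton_polytope f" if v: "v extreme_point_of K" for v
  proof -
    obtain \<alpha> where \<alpha>: "\<alpha> \<in> S" "v = real_vec \<alpha>"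
      using extreme_point_of_convex_hull[of v "real_vec ` S"] v by (auto simp: K_def)
    \<comment> \<open>Two distinct exponents with sum \<open>\<alpha> + \<alpha>\<close> would put
      \<open>v\<close> in the middle of a segment in \<open>K\<close>, against extremality.\<close>
    have diag: "\<beta> = \<beta>'" if "\<beta> \<in> S" "\<beta>' \<in> S" "\<beta> + \<beta>' = \<alpha> + \<alpha>" for \<beta> \<beta>'
    proof (rule ccontr)
      assume "\<beta> \<noteq> \<beta>'"
      then have "real_vec \<beta> \<noteq> real_vec \<beta>'"
        by (auto simp: real_vec_def vec_eq_iff)
      moreover have "v = midpoint (real_vec \<beta>) (real_vec \<beta>')"
      proof -
        have "real (\<beta> $ i) + real (\<beta>' $ i) = 2 * real (\<alpha> $ i)" for i
          using arg_cong[OF that(3), of "\<lambda>\<alpha>. real (\<alpha> $ i)"] by simp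
        then show ?thesis
          by (simp add: \<alpha> midpoint_def real_vec_def vec_eq_iff)
      qed
      ultimately have "v \<in> open_segment (real_vec \<beta>) (real_vec \<beta>')"
        by simp
      moreover have "real_vec \<beta> \<in> K" "real_vec \<beta>' \<in> K"
        using that by (auto simp: K_def intro: hull_inc)
      ultimately show False
        using v by (auto simp: extreme_point_of_def)
    qed
    have lk: "Poly_Mapping.lookup ((g i)\<^sup>2) (\<alpha> + \<alpha>)
        = (\<Sum>\<beta>\<in>Poly_Mapping.keys (g i). if \<beta> + \<beta> = \<alpha> + \<alpha> then (Poly_Mapping.lookup (g i) \<beta>)\<^sup>2 else 0)"
      if "i < m" for i
      by (rule lookup_square_diagonal) (use that in \<open>auto simp: S_def intro!: diag\<close>)
    obtain i where i: "i < m" "\<alpha> \<in> Poly_Mapping.keys (g i)"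
      using \<alpha>(1) by (auto simp: S_def)
    have "Poly_Mapping.lookup ((g i)\<^sup>2) (\<alpha> + \<alpha>) > 0"
      unfolding lk[OF i(1)] by (rule sum_pos2[of _ \<alpha>]) (use i in \<open>auto simp: in_keys_iff\<close>)
    moreover have "Poly_Mapping.lookup ((g l)\<^sup>2) (\<alpha> + \<alpha>) \<ge> 0" if "l < m" for l
      unfolding lk[OF that] by (intro sum_nonneg) auto
    ultimately have "Poly_Mapping.lookup f (\<alpha> + \<alpha>) > 0"
      unfolding f_def lookup_sum using i(1) by (intro sum_pos2[of _ i]) auto
    then have "real_vec (\<alpha> + \<alpha>) \<in> newton_polytope f"
      unfolding newton_polytope_def by (intro hull_inc imageI) (auto simp: in_keys_iff)
    moreover have "real_vec (\<alpha> + \<alpha>) = 2 *\<^sub>R v"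
      by (simp add: \<alpha> real_vec_def vec_eq_iff)
    ultimately show ?thesis by simp
  qed
  \<comment> \<open>Doubling sends the extreme points of \<open>K\<close> into a convex set, hence
    by the Krein-Milman theorem all of \<open>K\<close>.\<close>
  have "convex ((\<lambda>v. 2 *\<^sub>R v) -` newton_polytope f)"
    by (intro convex_linear_vimage) (auto simp: newton_polytope_def linear_iff scaleR_add_right)
  then have "convex hull {v. v extreme_point_of K} \<subseteq> (\<lambda>v. 2 *\<^sub>R v) -` newton_polytope f"
    by (intro hull_minimal) (use ext in auto)
  moreover have "K = convex hull {v. v extreme_point_of K}"
    by (rule Krein_Milman_Minkowski) fact+
  moreover have "real_vec \<gamma> \<in> K"
    using assms by (auto simp: K_def S_def intro!: hull_inc)
  ultimately show ?thesis
    by (auto simp: f_def)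
qed

subsection \<open>The other cases\<close>

lemma affine_independent_imageI:
  fixes F :: "'a \<Rightarrow> real ^ ('n::finite)"
  assumes "finite T" "inj_on F T"
    and indep: "\<And>u. (\<Sum>t\<in>T. u t) = 0 \<Longrightarrow> (\<And>i. (\<Sum>t\<in>T. u t * F t $ i) = 0) \<Longrightarrow> \<forall>t\<in>T. u t = (0::real)"
  shows "\<not> affine_dependent (F ` T)"
proof
  assume "affine_dependent (F ` T)"
  then obtain U v where U: "sum U (F ` T) = 0" "v \<in> F ` T" "U v \<noteq> 0" "(\<Sum>v\<in>F ` T. U v *\<^sub>R v) = 0"
    using assms(1) by (auto simp: affine_dependent_explicit_finite)
  have "(\<Sum>t\<in>T. U (F t)) = 0" "(\<Sum>t\<in>T. U (F t) *\<^sub>R F t) = 0"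
    using U(1,4) assms(2) by (simp_all add: sum.reindex)
  moreover from this(2) have "(\<Sum>t\<in>T. U (F t) * F t $ i) = 0" for i
    by (drule_tac arg_cong[of _ _ "\<lambda>v. v $ i"]) simp
  ultimately have "\<forall>t\<in>T. U (F t) = 0"
    using indep[of "\<lambda>t. U (F t)"] by blast
  with U(2,3) show False by blast
qed

text \<open>Turns membership in a hull of exponents into linear inequalities between coordinates,
  from which the lattice points in question are found.\<close>

lemma convex_hull_linear_le:
  fixes h :: "real ^ ('n::finite) \<Rightarrow> real"
  assumes "v \<in> convex hull S" "linear h" "\<And>s. s \<in> S \<Longrightarrow> h s \<le> r"
  shows "h v \<le> r"
proof -
  have "convex (h -` {..r})"
    by (rule convex_linear_vimage) (use assms(2) in auto)
  then have "convex hull S \<subseteq> h -` {..r}"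
    using assms(3) by (intro hull_minimal) auto
  then show ?thesis using assms(1) by auto
qed

text \<open>
  The witness is the circuit with vertices \<open>2T\<close> and inner exponent \<open>\<beta>\<close> at their barycentre, plus
  the square of the sum of the monomials with exponents in \<open>T\<close>. The coefficient of \<open>\<beta>\<close> is the one
  for which the inequality of arithmetic and geometric means is tight, with the sign that makes the
  parity sum of the circuit vanish.
\<close>

lemma sos_plus_sonc_not_union:
  fixes T :: "(nat ^ ('n::finite)) set" and \<beta> :: "nat ^ 'n"
  defines "b \<equiv> - real (card T) * parity_sign \<beta>"
  assumes T: "finite T" "card T \<ge> 3" "\<And>\<gamma>. \<gamma> \<in> T \<Longrightarrow> mdeg \<gamma> = d"
    and indep: "\<And>u. (\<Sum>\<gamma>\<in>T. u \<gamma>) = 0 \<Longrightarrow> (\<And>i. (\<Sum>\<gamma>\<in>T. u \<gamma> * real (\<gamma> $ i)) = 0) \<Longrightarrow> \<forall>\<gamma>\<in>T. u \<gamma> = (0::real)"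
    and bary: "\<And>i. (\<Sum>\<gamma>\<in>T. 2 * \<gamma> $ i) = card T * \<beta> $ i"
    and odd: "\<And>\<gamma> \<gamma>'. \<gamma> \<in> T \<Longrightarrow> \<gamma>' \<in> T \<Longrightarrow> \<gamma> \<noteq> \<gamma>' \<Longrightarrow> \<exists>i. odd (\<gamma> $ i + \<gamma>' $ i)"
    and nonneg: "\<And>x :: real ^ 'n. (\<Sum>\<gamma>\<in>T. (\<Prod>i\<in>UNIV. (x $ i) ^ (\<gamma> $ i))\<^sup>2) + b * (\<Prod>i\<in>UNIV. (x $ i) ^ (\<beta> $ i)) \<ge> 0"
    and \<beta>_sum: "\<And>\<gamma> \<gamma>'. \<gamma> \<in> T \<Longrightarrow> \<gamma>' \<in> T \<Longrightarrow> \<gamma> + \<gamma>' \<noteq> \<beta>"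
    and lattice: "\<And>\<alpha> \<alpha>'. real_vec \<alpha> \<in> convex hull (real_vec ` T) \<Longrightarrow>
      real_vec \<alpha>' \<in> convex hull (real_vec ` T) \<Longrightarrow> \<alpha> + \<alpha>' = \<beta> \<Longrightarrow> \<alpha> = \<alpha>'"
  shows "(sos d \<union> sonc (2 * d) :: 'n mpol set) \<noteq> sos_plus_sonc d"
proof -
  define N where "N = real (card T)"
  have N: "N \<ge> 3" using T(2) by (simp add: N_def)
  define q :: "'n mpol" where "q = (\<Sum>\<gamma>\<in>T. Poly_Mapping.single \<gamma> 1)"
  define c :: "'n mpol" where "c = (\<Sum>\<gamma>\<in>T. Poly_Mapping.single (\<gamma> + \<gamma>) 1) + Poly_Mapping.single \<beta> b"
  have q2: "q\<^sup>2 = (\<Sum>\<gamma>\<in>T. \<Sum>\<gamma>'\<in>T. Poly_Mapping.single (\<gamma> + \<gamma>') 1)"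
    by (simp add: q_def power2_eq_square sum_product mult_single)
  let ?D = "\<lambda>\<gamma>. real_vec (\<gamma> + \<gamma>) :: real ^ 'n"
  have dbl_inj: "\<gamma> + \<gamma> = \<gamma>' + \<gamma>' \<longleftrightarrow> \<gamma> = \<gamma>'" for \<gamma> \<gamma>' :: "nat ^ 'n"
    by (simp add: vec_eq_iff) (metis mult_2 mult_left_cancel zero_neq_numeral)
  have D: "?D \<gamma> = 2 *\<^sub>R real_vec \<gamma>" for \<gamma>
    by (simp add: real_vec_def vec_eq_iff)
  have D_inj: "inj_on ?D T"
    by (intro inj_onI) (simp add: dbl_inj inj_eq[OF inj_real_vec])
  have b0: "b \<noteq> 0"
    using N by (simp add: b_def N_def[symmetric] parity_sign_def)
  have bary': "real_vec \<beta> = (\<Sum>\<gamma>\<in>T. (1 / N) *\<^sub>R ?D \<gamma>)"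
  proof -
    have "N * real (\<beta> $ i) = (\<Sum>\<gamma>\<in>T. 2 * real (\<gamma> $ i))" for i
      using arg_cong[OF bary[of i], of real] by (simp add: N_def)
    then have "real (\<beta> $ i) = (1 / N) * (\<Sum>\<gamma>\<in>T. 2 * real (\<gamma> $ i))" for i
      using N by (simp add: field_simps)
    then show ?thesis
      by (simp add: vec_eq_iff D real_vec_def sum_distrib_left)
  qed
  have lk: "Poly_Mapping.lookup (\<Sum>\<gamma>\<in>T. Poly_Mapping.single (\<gamma> + \<gamma>) 1) \<delta>
      = (if \<delta> \<in> (\<lambda>\<gamma>. \<gamma> + \<gamma>) ` T then 1 else (0::real))" for \<delta>
  proof (cases "\<delta> \<in> (\<lambda>\<gamma>. \<gamma> + \<gamma>) ` T")
    case True
    then obtain \<gamma> where "\<gamma> \<in> T" "\<delta> = \<gamma> + \<gamma>" by blast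
    then show ?thesis
      using T(1) by (simp add: lookup_sum lookup_single when_def dbl_inj sum.delta')
  next
    case False
    then show ?thesis
      by (auto simp: lookup_sum lookup_single when_def intro!: sum.neutral)
  qed
  have \<beta>_dbl: "\<beta> \<notin> (\<lambda>\<gamma>. \<gamma> + \<gamma>) ` T"
    using \<beta>_sum by blast
  have c_lookup: "Poly_Mapping.lookup c \<delta> = (if \<delta> \<in> (\<lambda>\<gamma>. \<gamma> + \<gamma>) ` T then 1 else if \<delta> = \<beta> then b else 0)" for \<delta>
    using \<beta>_dbl by (auto simp: c_def lookup_add lk lookup_single when_def)
  have c_keys: "Poly_Mapping.keys c = insert \<beta> ((\<lambda>\<gamma>. \<gamma> + \<gamma>) ` T)"
    using b0 by (auto simp: in_keys_iff c_lookup split: if_splits)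
  have c_square: "square_supp c = (\<lambda>\<gamma>. \<gamma> + \<gamma>) ` T"
    using N \<beta>_dbl by (auto simp: square_supp_def c_keys c_lookup b_def parity_sign_def)
  have c_inner: "inner_supp c = {\<beta>}"
    using \<beta>_dbl by (auto simp: inner_supp_def c_square c_keys)
  have D_indep: "\<not> affine_dependent (?D ` T)"
  proof (rule affine_independent_imageI[OF T(1) D_inj])
    fix u :: "nat ^ 'n \<Rightarrow> real"
    assume "(\<Sum>\<gamma>\<in>T. u \<gamma>) = 0" and *: "\<And>i. (\<Sum>\<gamma>\<in>T. u \<gamma> * ?D \<gamma> $ i) = 0"
    moreover have "2 * (\<Sum>\<gamma>\<in>T. u \<gamma> * real (\<gamma> $ i)) = 0" for i
      using *[of i] by (simp add: D real_vec_def mult.left_commute sum_distrib_left)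
    then have "(\<Sum>\<gamma>\<in>T. u \<gamma> * real (\<gamma> $ i)) = 0" for i
      by simp
    ultimately show "\<forall>\<gamma>\<in>T. u \<gamma> = 0" using indep by blast
  qed
  \<comment> \<open>All barycentric coordinates of \<beta> equal \<open>1 / N\<close> and are thus
    positive.\<close>
  have rel: "real_vec \<beta> \<in> rel_interior (convex hull (?D ` T))"
  proof -
    have "(\<Sum>v\<in>?D ` T. 1 / N) = 1" "(\<Sum>v\<in>?D ` T. (1 / N) *\<^sub>R v) = real_vec \<beta>"
      using N by (simp_all add: sum.reindex[OF D_inj] bary' card_image[OF D_inj] N_def)
    moreover have "\<forall>v\<in>?D ` T. 0 < 1 / N" using N by simp
    ultimately show ?thesis
      unfolding rel_interior_convex_hull_explicit[OF D_indep]
      by (intro CollectI exI[of _ "\<lambda>_. 1 / N"] conjI)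
  qed
  have New: "newton_polytope c = convex hull (?D ` T)"
  proof -
    have "real_vec \<beta> \<in> convex hull (?D ` T)"
      using rel rel_interior_subset by blast
    then show ?thesis
      by (simp add: newton_polytope_def c_keys image_image hull_redundant)
  qed
  have "newton_vertices c = ?D ` T"
    unfolding newton_vertices_def New
    using extreme_point_of_convex_hull_affine_independent[OF D_indep] by auto
  then have "circuit c"
    unfolding circuit_def c_inner c_square New using D_indep rel by (simp add: image_image)
  moreover have "mpol_eval c x \<ge> 0" for x
    using nonneg[of x]
    by (simp add: c_def mpol_eval_add mpol_eval_sum mpol_eval_single power_add prod.distrib power2_eq_square)
  ultimately have "nonneg_circuit c"
    by (simp add: nonneg_circuit_def)
  moreover have "c \<in> forms (2 * d)"
  proof -
    have "card T * mdeg \<beta> = (\<Sum>i\<in>UNIV. \<Sum>\<gamma>\<in>T. 2 * \<gamma> $ i)"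
      by (simp add: bary sum_distrib_left)
    also have "\<dots> = (\<Sum>\<gamma>\<in>T. 2 * mdeg \<gamma>)"
      by (subst sum.swap) (simp add: sum_distrib_left)
    also have "\<dots> = card T * (2 * d)"
      using T(3) by simp
    finally have "mdeg \<beta> = 2 * d"
      using T(2) by simp
    then show ?thesis
      unfolding c_def using T(3) by (intro forms_add forms_sum single_in_forms) (auto simp: sum.distrib)
  qed
  ultimately have "c \<in> sonc (2 * d)"
    unfolding sonc_def by (auto intro!: exI[of _ "Suc 0"] exI[of _ "\<lambda>_. c"])
  moreover have "q\<^sup>2 \<in> sos d"
    unfolding q_def using T(3) by (intro square_in_sos forms_sum single_in_forms)
  ultimately have "q\<^sup>2 + c \<in> sos_plus_sonc d"
    unfolding sos_plus_sonc_def by blast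
  moreover have "q\<^sup>2 + c \<notin> sonc (2 * d)"
  proof -
    \<comment> \<open>Each of the \<open>N\<close> diagonal pairs contributes 1 and, by
      \<open>odd\<close>, each of the \<open>N * (N - 1)\<close> others contributes -1. The total is
      negative from three vertices on.\<close>
    have "parity_sum (q\<^sup>2) = (\<Sum>\<gamma>\<in>T. \<Sum>\<gamma>'\<in>T. parity_sign (\<gamma> + \<gamma>'))"
      by (simp add: q2 parity_sum_sum parity_sum_single)
    also have "\<dots> = (\<Sum>\<gamma>\<in>T. \<Sum>\<gamma>'\<in>T. (if \<gamma> = \<gamma>' then 2 else 0) - 1)"
      using odd by (intro sum.cong refl) (auto simp: parity_sign_def)
    also have "\<dots> = N * (2 - N)"
      using T(1) by (simp add: sum_subtractf sum.delta N_def algebra_simps)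
    finally have "parity_sum (q\<^sup>2) = N * (2 - N)" .
    moreover have "parity_sum c = N + b * parity_sign \<beta>"
      by (simp add: c_def parity_sum_add parity_sum_sum parity_sum_single parity_sign_def N_def)
    then have "parity_sum c = 0"
      by (simp add: b_def N_def parity_sign_def)
    ultimately have "parity_sum (q\<^sup>2 + c) < 0"
      using N by (simp add: parity_sum_add mult_less_0_iff)
    then show ?thesis
      using parity_sum_sonc by force
  qed
  moreover have "q\<^sup>2 + c \<notin> sos d"
  proof
    assume "q\<^sup>2 + c \<in> sos d"
    then obtain m :: nat and g where f: "q\<^sup>2 + c = (\<Sum>j<m. (g j)\<^sup>2)"
      by (auto simp: sos_def)
    have q2_lookup: "Poly_Mapping.lookup (q\<^sup>2) \<delta> = 0" if "\<And>\<gamma> \<gamma>'. \<gamma> \<in> T \<Longrightarrow> \<gamma>' \<in> T \<Longrightarrow> \<gamma> + \<gamma>' \<noteq> \<delta>" for \<delta>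
      unfolding q2 lookup_sum lookup_single when_def using that by (intro sum.neutral ballI) simp
    have keys: "\<alpha> = \<beta> \<or> (\<exists>\<gamma>\<in>T. \<exists>\<gamma>'\<in>T. \<alpha> = \<gamma> + \<gamma>')" if "\<alpha> \<in> Poly_Mapping.keys (q\<^sup>2 + c)" for \<alpha>
    proof (rule ccontr)
      assume not: "\<not> ?thesis"
      then have "Poly_Mapping.lookup (q\<^sup>2) \<alpha> = 0"
        by (intro q2_lookup) blast
      moreover have "Poly_Mapping.lookup c \<alpha> = 0"
        using not by (auto simp: c_lookup)
      ultimately show False
        using that by (simp add: in_keys_iff lookup_add)
    qed
    \<comment> \<open>Halved exponents lie in the hull of \<open>T\<close>: sums of two elements of
      \<open>T\<close> become midpoints, and half of \<beta> is the barycentre. The support of every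
      squared form is therefore confined to this hull.\<close>
    have "newton_polytope (q\<^sup>2 + c) \<subseteq> (\<lambda>v. (1 / 2) *\<^sub>R v) -` (convex hull (real_vec ` T))"
      unfolding newton_polytope_def
    proof (rule hull_minimal)
      show "convex ((\<lambda>v. (1 / 2) *\<^sub>R v) -` (convex hull (real_vec ` T) :: (real ^ 'n) set))"
        by (intro convex_linear_vimage) (auto simp: linear_iff scaleR_add_right)
      have "(1 / 2) *\<^sub>R real_vec (\<gamma> + \<gamma>') \<in> convex hull (real_vec ` T)" if "\<gamma> \<in> T" "\<gamma>' \<in> T" for \<gamma> \<gamma>'
      proof -
        have "(1 / 2) *\<^sub>R real_vec (\<gamma> + \<gamma>') = (1 / 2) *\<^sub>R real_vec \<gamma> + (1 / 2) *\<^sub>R real_vec \<gamma>'"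
          by (simp add: real_vec_def vec_eq_iff add_divide_distrib)
        also have "\<dots> \<in> convex hull (real_vec ` T)"
          using that by (intro convexD[OF convex_convex_hull] hull_inc imageI) auto
        finally show ?thesis .
      qed
      moreover have "(1 / 2) *\<^sub>R real_vec \<beta> \<in> convex hull (real_vec ` T)"
      proof -
        have "(1 / 2) *\<^sub>R real_vec \<beta> = (\<Sum>\<gamma>\<in>T. (1 / N) *\<^sub>R real_vec \<gamma>)"
          by (simp add: bary' D scaleR_sum_right)
        also have "\<dots> \<in> convex hull (real_vec ` T)"
          using T(1) N by (intro convex_sum) (auto simp: N_def intro: hull_inc)
        finally show ?thesis .
      qed
      ultimately show "real_vec ` Poly_Mapping.keys (q\<^sup>2 + c) \<subseteq> (\<lambda>v. (1 / 2) *\<^sub>R v) -` (convex hull (real_vec ` T))"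
        by (auto dest!: keys)
    qed
    then have supp: "real_vec \<alpha> \<in> convex hull (real_vec ` T)" if "j < m" "\<alpha> \<in> Poly_Mapping.keys (g j)" for j \<alpha>
      using sos_summand_newton_polytope[where g = g, OF that] unfolding f by auto
    \<comment> \<open>By \<open>lattice\<close>, two exponents in this hull add up to \<beta> only
      if they are equal.\<close>
    have diag: "Poly_Mapping.lookup ((g j)\<^sup>2) \<beta>
        = (\<Sum>\<alpha>\<in>Poly_Mapping.keys (g j). if \<alpha> + \<alpha> = \<beta> then (Poly_Mapping.lookup (g j) \<alpha>)\<^sup>2 else 0)"
      if "j < m" for j
      by (rule lookup_square_diagonal) (use that in \<open>auto intro!: lattice supp\<close>)
    have "Poly_Mapping.lookup (q\<^sup>2) \<beta> = 0"
      by (rule q2_lookup) (rule \<beta>_sum)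
    then have "Poly_Mapping.lookup (q\<^sup>2 + c) \<beta> = b"
      using \<beta>_dbl by (simp add: lookup_add c_lookup)
    then have b_eq: "b = (\<Sum>j<m. Poly_Mapping.lookup ((g j)\<^sup>2) \<beta>)"
      unfolding f by (simp add: lookup_sum)
    show False
    \<comment> \<open>If all entries of \<beta> are even, \<open>b\<close> is negative and cannot be
      a sum of squares. Otherwise \<beta> is not the double of an exponent and its coefficient would
      have to vanish.\<close>
    proof (cases "\<forall>i. even (\<beta> $ i)")
      case True
      then have "b < 0"
        using N by (simp add: b_def parity_sign_def N_def)
      moreover have "b \<ge> 0"
        unfolding b_eq using diag by (intro sum_nonneg) (auto intro!: sum_nonneg)
      ultimately show ?thesis by simp
    next
      case False
      then have "\<alpha> + \<alpha> \<noteq> \<beta>" for \<alpha>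
        by auto
      then have "b = 0"
        unfolding b_eq using diag by (intro sum.neutral) auto
      with b0 show ?thesis by simp
    qed
  qed
  ultimately show ?thesis by blast
qed

section \<open>Nonnegativity of the Motzkin and Choi-Lam forms\<close>

lemma motzkin_nonneg:
  fixes X Y Z :: real
  shows "X ^ 4 * Y\<^sup>2 + X\<^sup>2 * Y ^ 4 + Z ^ 6 - 3 * X\<^sup>2 * Y\<^sup>2 * Z\<^sup>2 \<ge> 0"
proof -
  \<comment> \<open>The form equals \<open>p * (s - 3 * t) + t^3\<close>. Where the bracket is
    negative, \<open>4 * p \<le> s^2\<close> bounds it from below by a quarter of
    \<open>(s - 2 * t)^2 * (s + t)\<close>.\<close>
  define p s t where "p = X\<^sup>2 * Y\<^sup>2" and "s = X\<^sup>2 + Y\<^sup>2" and "t = Z\<^sup>2"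
  have "s \<ge> 0" "t \<ge> 0" "p \<ge> 0" by (simp_all add: s_def t_def p_def)
  have ps: "4 * p \<le> s\<^sup>2"
    using zero_le_power2[of "X\<^sup>2 - Y\<^sup>2"] by (simp add: p_def s_def power2_eq_square algebra_simps)
  have "p * (s - 3 * t) + t ^ 3 \<ge> 0"
  proof (cases "s \<ge> 3 * t")
    case True
    then show ?thesis using \<open>p \<ge> 0\<close> \<open>t \<ge> 0\<close> by simp
  next
    case False
    then have "4 * p * (s - 3 * t) \<ge> s\<^sup>2 * (s - 3 * t)"
      using ps by (intro mult_right_mono_neg) auto
    moreover have "s\<^sup>2 * (s - 3 * t) + 4 * t ^ 3 = (s - 2 * t)\<^sup>2 * (s + t)"
      by (simp add: power2_eq_square power3_eq_cube algebra_simps)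
    moreover have "\<dots> \<ge> 0" using \<open>s \<ge> 0\<close> \<open>t \<ge> 0\<close> by simp
    ultimately show ?thesis by linarith
  qed
  moreover have "t ^ 3 = Z ^ 6" using power_mult[of Z 2 3] by (simp add: t_def)
  ultimately show ?thesis
    by (simp add: p_def s_def t_def power2_eq_square power4_eq_xxxx algebra_simps)
qed

lemma choi_lam_nonneg:
  fixes X Y Z W :: real
  shows "W ^ 4 + X\<^sup>2 * Y\<^sup>2 + Y\<^sup>2 * Z\<^sup>2 + Z\<^sup>2 * X\<^sup>2 + 4 * X * Y * Z * W \<ge> 0"
proof -
  \<comment> \<open>The arithmetic-geometric mean inequality is applied to \<open>W^4\<close> and
    \<open>X^2 Y^2\<close>, to the two terms containing \<open>Z^2\<close>, and then to the two
    lower bounds obtained.\<close>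
  have "0 \<le> (W\<^sup>2 - \<bar>X * Y\<bar>)\<^sup>2" "0 \<le> Z\<^sup>2 * (\<bar>X\<bar> - \<bar>Y\<bar>)\<^sup>2" "0 \<le> 2 * \<bar>X * Y\<bar> * (\<bar>W\<bar> - \<bar>Z\<bar>)\<^sup>2"
    by simp_all
  then have "2 * W\<^sup>2 * \<bar>X * Y\<bar> \<le> W ^ 4 + X\<^sup>2 * Y\<^sup>2"
    "2 * Z\<^sup>2 * \<bar>X * Y\<bar> \<le> Y\<^sup>2 * Z\<^sup>2 + Z\<^sup>2 * X\<^sup>2"
    "4 * \<bar>X * Y * Z * W\<bar> \<le> 2 * W\<^sup>2 * \<bar>X * Y\<bar> + 2 * Z\<^sup>2 * \<bar>X * Y\<bar>"
    by (simp_all add: power2_diff abs_mult power_mult_distrib algebra_simps flip: power_mult)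
  moreover have "4 * X * Y * Z * W \<ge> - (4 * \<bar>X * Y * Z * W\<bar>)"
    using abs_ge_minus_self[of "X * Y * Z * W"] by linarith
  ultimately show ?thesis by linarith
qed

text \<open>The circuit is the Motzkin form times \<open>z^(2e)\<close> with
  \<open>e = d - 3\<close>; \<open>T\<close> holds the halves of its vertex exponents.\<close>

lemma ternary_not_union:
  fixes x y z :: "'n::finite"
  assumes "distinct [x, y, z]" "d \<ge> 3"
  shows "(sos d \<union> sonc (2 * d) :: 'n mpol set) \<noteq> sos_plus_sonc d"
proof -
  obtain e where d: "d = e + 3" using assms(2) by (metis add.commute le_Suc_ex)
  let ?E = "ternary_exponent x y z"
  have nth: "?E i j l $ x = i" "?E i j l $ y = j" "?E i j l $ z = l" for i j l
    using assms(1) by (simp_all add: ternary_exponent_nth)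
  have other: "?E i j l $ k = 0" if "k \<notin> {x, y, z}" for i j l k
    using ternary_exponent_nth(4)[OF assms(1) that] .
  have inj: "?E i j l = ?E i' j' l' \<longleftrightarrow> i = i' \<and> j = j' \<and> l = l'" for i j l i' j' l'
    by (metis nth)
  define T where "T = {?E 2 1 e, ?E 1 2 e, ?E 0 0 d}"
  define \<beta> where "\<beta> = ?E 2 2 (2 * e + 2)"
  have sum_T: "(\<Sum>\<gamma>\<in>T. h \<gamma>) = h (?E 2 1 e) + h (?E 1 2 e) + h (?E 0 0 d)" for h :: "_ \<Rightarrow> 'b::comm_monoid_add"
    by (simp add: T_def inj add.assoc)
  have card: "card T = 3" by (simp add: T_def inj)
  have \<beta>_even: "even (\<beta> $ k)" for k
    by (cases "k \<in> {x, y, z}") (auto simp: \<beta>_def nth other)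
  have sign: "parity_sign \<beta> = 1"
    using \<beta>_even by (simp add: parity_sign_def)
  have ball_T: "(\<forall>\<gamma>\<in>T. P \<gamma>) \<longleftrightarrow> P (?E 2 1 e) \<and> P (?E 1 2 e) \<and> P (?E 0 0 d)" for P
    by (simp add: T_def)
  show ?thesis
  proof (rule sos_plus_sonc_not_union[where T = T and \<beta> = \<beta>])
    show "finite T" "card T \<ge> 3" by (simp_all add: T_def inj)
    show "mdeg \<gamma> = d" if "\<gamma> \<in> T" for \<gamma>
      using that by (auto simp: T_def mdeg_ternary_exponent d)
    show "\<forall>\<gamma>\<in>T. u \<gamma> = 0" if "(\<Sum>\<gamma>\<in>T. u \<gamma>) = 0" "\<And>i. (\<Sum>\<gamma>\<in>T. u \<gamma> * real (\<gamma> $ i)) = 0" for u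
      using that(1) that(2)[of x] that(2)[of y] by (simp add: sum_T nth ball_T)
    show "(\<Sum>\<gamma>\<in>T. 2 * \<gamma> $ i) = card T * \<beta> $ i" for i
      by (cases "i \<in> {x, y, z}") (auto simp: sum_T card \<beta>_def nth other d)
    show "\<exists>i. odd (\<gamma> $ i + \<gamma>' $ i)" if "\<gamma> \<in> T" "\<gamma>' \<in> T" "\<gamma> \<noteq> \<gamma>'" for \<gamma> \<gamma>'
    proof -
      have "odd (\<gamma> $ x + \<gamma>' $ x) \<or> odd (\<gamma> $ y + \<gamma>' $ y)"
        using that by (auto simp: T_def nth)
      then show ?thesis by blast
    qed
    show "\<gamma> + \<gamma>' \<noteq> \<beta>" if "\<gamma> \<in> T" "\<gamma>' \<in> T" for \<gamma> \<gamma>'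
      using that by (auto simp: T_def \<beta>_def ternary_exponent_add inj)
    show "(\<Sum>\<gamma>\<in>T. (\<Prod>i\<in>UNIV. (v $ i) ^ (\<gamma> $ i))\<^sup>2)
        + - real (card T) * parity_sign \<beta> * (\<Prod>i\<in>UNIV. (v $ i) ^ (\<beta> $ i)) \<ge> 0" for v :: "real ^ 'n"
    proof -
      have mono: "(\<Prod>m\<in>UNIV. (v $ m) ^ (?E i j l $ m)) = (v $ x) ^ i * (v $ y) ^ j * (v $ z) ^ l" for i j l
        using mpol_eval_ternary[OF assms(1), of i j l 1 v] by (simp add: mpol_eval_single)
      define X Y Z p where "X = v $ x" and "Y = v $ y" and "Z = v $ z" and "p = (v $ z) ^ e"
      have "0 \<le> p\<^sup>2 * (X ^ 4 * Y\<^sup>2 + X\<^sup>2 * Y ^ 4 + Z ^ 6 - 3 * X\<^sup>2 * Y\<^sup>2 * Z\<^sup>2)"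
        by (intro mult_nonneg_nonneg motzkin_nonneg) simp
      also have "\<dots> = (X\<^sup>2 * Y * p)\<^sup>2 + (X * Y\<^sup>2 * p)\<^sup>2 + (p * Z ^ 3)\<^sup>2 - 3 * (X\<^sup>2 * Y\<^sup>2 * (p\<^sup>2 * Z\<^sup>2))"
        by (simp add: power_mult_distrib algebra_simps flip: power_mult)
      also have "\<dots> = (\<Sum>\<gamma>\<in>T. (\<Prod>i\<in>UNIV. (v $ i) ^ (\<gamma> $ i))\<^sup>2)
          + - real (card T) * parity_sign \<beta> * (\<Prod>i\<in>UNIV. (v $ i) ^ (\<beta> $ i))"
        unfolding sum_T card sign unfolding \<beta>_def mono
        by (simp add: d X_def Y_def Z_def p_def power_add power_even_eq) (simp add: power2_eq_square mult_ac)
      finally show ?thesis .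
    qed
    show "\<alpha> = \<alpha>'" if \<alpha>: "real_vec \<alpha> \<in> convex hull (real_vec ` T)"
      "real_vec \<alpha>' \<in> convex hull (real_vec ` T)" and sum: "\<alpha> + \<alpha>' = \<beta>" for \<alpha> \<alpha>'
    proof -
      \<comment> \<open>The first two inequalities force the \<open>x\<close>- and
        \<open>y\<close>-entries to vanish together. As the two parts have sum 2 in both entries,
        (0, 0) would need the partner (2, 2), which violates the bound 3, and only (1, 1) twice is
        left. The degree then determines the \<open>z\<close>-entry.\<close>
      have bounds: "\<alpha> $ x \<le> 2 * \<alpha> $ y \<and> \<alpha> $ y \<le> 2 * \<alpha> $ x \<and> \<alpha> $ x + \<alpha> $ y \<le> 3 \<and> \<alpha> $ x + \<alpha> $ y + \<alpha> $ z = d"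
        if h: "real_vec \<alpha> \<in> convex hull (real_vec ` T)" for \<alpha>
      proof -
        note le = convex_hull_linear_le[OF h]
        have "real_vec \<alpha> $ x - 2 * real_vec \<alpha> $ y \<le> 0"
          by (rule le) (auto simp: linear_iff algebra_simps T_def real_vec_def nth)
        moreover have "real_vec \<alpha> $ y - 2 * real_vec \<alpha> $ x \<le> 0"
          by (rule le) (auto simp: linear_iff algebra_simps T_def real_vec_def nth)
        moreover have "real_vec \<alpha> $ x + real_vec \<alpha> $ y \<le> 3"
          by (rule le) (auto simp: linear_iff algebra_simps T_def real_vec_def nth)
        moreover have "real_vec \<alpha> $ x + real_vec \<alpha> $ y + real_vec \<alpha> $ z \<le> d"
          by (rule le) (auto simp: linear_iff algebra_simps T_def real_vec_def nth d)
        moreover have "- (real_vec \<alpha> $ x + real_vec \<alpha> $ y + real_vec \<alpha> $ z) \<le> - real d"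
          by (rule le) (auto simp: linear_iff algebra_simps T_def real_vec_def nth d)
        ultimately show ?thesis
          unfolding real_vec_def vec_lambda_beta by linarith
      qed
      have s: "\<alpha> $ k + \<alpha>' $ k = \<beta> $ k" for k
        using sum by (metis vector_add_component)
      have "\<alpha> $ x + \<alpha>' $ x = 2" "\<alpha> $ y + \<alpha>' $ y = 2"
        using s[of x] s[of y] by (simp_all add: \<beta>_def nth)
      moreover from this have "\<alpha> $ x = 1" "\<alpha> $ y = 1"
        using bounds[OF \<alpha>(1)] bounds[OF \<alpha>(2)] by linarith+
      ultimately have xy: "\<alpha> $ x = 1" "\<alpha>' $ x = 1" "\<alpha> $ y = 1" "\<alpha>' $ y = 1"
        by simp_all
      have "\<alpha> $ k = \<alpha>' $ k" for k
      proof (cases "k \<in> {x, y, z}")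
        case True
        then show ?thesis
          using xy bounds[OF \<alpha>(1)] bounds[OF \<alpha>(2)] by auto
      next
        case False
        then show ?thesis
          using s[of k] by (simp add: \<beta>_def other)
      qed
      then show ?thesis by (simp add: vec_eq_iff)
    qed
  qed
qed

text \<open>The circuit is the Choi-Lam quartic with vertices \<open>x^2 y^2\<close>,
  \<open>y^2 z^2\<close>, \<open>z^2 x^2\<close>, \<open>w^4\<close> and inner monomial
  \<open>x y z w\<close>. The inner exponent has odd entries, so its coefficient is +4.\<close>

lemma quaternary_quartic_not_union:
  fixes x y z w :: "'n::finite"
  assumes "distinct [x, y, z, w]"
  shows "(sos 2 \<union> sonc (2 * 2) :: 'n mpol set) \<noteq> sos_plus_sonc 2"
proof -
  define E :: "nat \<Rightarrow> nat \<Rightarrow> nat \<Rightarrow> nat \<Rightarrow> nat ^ 'n"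
    where "E i j l m = axis x i + axis y j + axis z l + axis w m" for i j l m
  have nth: "E i j l m $ x = i" "E i j l m $ y = j" "E i j l m $ z = l" "E i j l m $ w = m" for i j l m
    using assms by (auto simp: E_def axis_def)
  have other: "E i j l m $ k = 0" if "k \<notin> {x, y, z, w}" for i j l m k
    using that by (auto simp: E_def axis_def)
  have inj: "E i j l m = E i' j' l' m' \<longleftrightarrow> i = i' \<and> j = j' \<and> l = l' \<and> m = m'" for i j l m i' j' l' m'
    by (metis nth)
  define T where "T = {E 1 1 0 0, E 0 1 1 0, E 1 0 1 0, E 0 0 0 2}"
  define \<beta> where "\<beta> = E 1 1 1 1"
  have sum_T: "(\<Sum>\<gamma>\<in>T. h \<gamma>) = h (E 1 1 0 0) + h (E 0 1 1 0) + h (E 1 0 1 0) + h (E 0 0 0 2)"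
    for h :: "_ \<Rightarrow> 'b::comm_monoid_add"
    by (simp add: T_def inj add.assoc)
  have card: "card T = 4" by (simp add: T_def inj)
  have "odd (\<beta> $ x)" by (simp add: \<beta>_def nth)
  then have sign: "parity_sign \<beta> = - 1"
    by (auto simp: parity_sign_def)
  have ball_T: "(\<forall>\<gamma>\<in>T. P \<gamma>) \<longleftrightarrow> P (E 1 1 0 0) \<and> P (E 0 1 1 0) \<and> P (E 1 0 1 0) \<and> P (E 0 0 0 2)" for P
    by (simp add: T_def)
  show ?thesis
  proof (rule sos_plus_sonc_not_union[where T = T and \<beta> = \<beta>])
    show "finite T" "card T \<ge> 3" by (simp_all add: T_def inj)
    show "mdeg \<gamma> = 2" if "\<gamma> \<in> T" for \<gamma>
      using that by (auto simp: T_def E_def sum.distrib simp del: axis_def)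
    show "\<forall>\<gamma>\<in>T. u \<gamma> = 0" if "(\<Sum>\<gamma>\<in>T. u \<gamma>) = 0" "\<And>i. (\<Sum>\<gamma>\<in>T. u \<gamma> * real (\<gamma> $ i)) = 0" for u
      using that(1) that(2)[of x] that(2)[of y] that(2)[of z] that(2)[of w] by (simp add: sum_T nth ball_T)
    show "(\<Sum>\<gamma>\<in>T. 2 * \<gamma> $ i) = card T * \<beta> $ i" for i
      by (cases "i \<in> {x, y, z, w}") (auto simp: sum_T card \<beta>_def nth other)
    show "\<exists>i. odd (\<gamma> $ i + \<gamma>' $ i)" if "\<gamma> \<in> T" "\<gamma>' \<in> T" "\<gamma> \<noteq> \<gamma>'" for \<gamma> \<gamma>'
    proof -
      have "odd (\<gamma> $ x + \<gamma>' $ x) \<or> odd (\<gamma> $ y + \<gamma>' $ y)"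
        using that by (auto simp: T_def nth)
      then show ?thesis by blast
    qed
    show "\<gamma> + \<gamma>' \<noteq> \<beta>" if "\<gamma> \<in> T" "\<gamma>' \<in> T" for \<gamma> \<gamma>'
    proof
      assume "\<gamma> + \<gamma>' = \<beta>"
      then have "\<gamma> $ k + \<gamma>' $ k = \<beta> $ k" for k by (metis vector_add_component)
      from this[of w] show False
        using that by (auto simp: T_def \<beta>_def nth)
    qed
    show "(\<Sum>\<gamma>\<in>T. (\<Prod>i\<in>UNIV. (v $ i) ^ (\<gamma> $ i))\<^sup>2)
        + - real (card T) * parity_sign \<beta> * (\<Prod>i\<in>UNIV. (v $ i) ^ (\<beta> $ i)) \<ge> 0" for v :: "real ^ 'n"
    proof -
      have mono: "(\<Prod>k\<in>UNIV. (v $ k) ^ (E i j l m $ k)) = (v $ x) ^ i * (v $ y) ^ j * (v $ z) ^ l * (v $ w) ^ m" for i j l m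
        using assms by (subst prod_power_support[of "{x, y, z, w}"]) (auto simp: nth other)
      show ?thesis
        unfolding sum_T card sign unfolding \<beta>_def mono
        using choi_lam_nonneg[of "v $ w" "v $ x" "v $ y" "v $ z"]
        by (simp add: power_mult_distrib mult_ac add_ac flip: power_mult)
    qed
    show "\<alpha> = \<alpha>'" if \<alpha>: "real_vec \<alpha> \<in> convex hull (real_vec ` T)"
      "real_vec \<alpha>' \<in> convex hull (real_vec ` T)" and sum: "\<alpha> + \<alpha>' = \<beta>" for \<alpha> \<alpha>'
    proof -
      \<comment> \<open>The triangle inequalities exclude exponents containing exactly one of
        \<open>x\<close>, \<open>y\<close>, \<open>z\<close> once, and the bound 2 excludes all
        three at once. One of two parts of \<beta> always violates this, so the condition on lattice
        points holds vacuously.\<close>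
      have bounds: "\<alpha> $ x \<le> \<alpha> $ y + \<alpha> $ z \<and> \<alpha> $ y \<le> \<alpha> $ x + \<alpha> $ z \<and> \<alpha> $ z \<le> \<alpha> $ x + \<alpha> $ y
          \<and> \<alpha> $ x + \<alpha> $ y + \<alpha> $ z \<le> 2"
        if h: "real_vec \<alpha> \<in> convex hull (real_vec ` T)" for \<alpha>
      proof -
        note le = convex_hull_linear_le[OF h]
        have "real_vec \<alpha> $ x - (real_vec \<alpha> $ y + real_vec \<alpha> $ z) \<le> 0"
          by (rule le) (auto simp: linear_iff algebra_simps T_def real_vec_def nth)
        moreover have "real_vec \<alpha> $ y - (real_vec \<alpha> $ x + real_vec \<alpha> $ z) \<le> 0"
          by (rule le) (auto simp: linear_iff algebra_simps T_def real_vec_def nth)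
        moreover have "real_vec \<alpha> $ z - (real_vec \<alpha> $ x + real_vec \<alpha> $ y) \<le> 0"
          by (rule le) (auto simp: linear_iff algebra_simps T_def real_vec_def nth)
        moreover have "real_vec \<alpha> $ x + real_vec \<alpha> $ y + real_vec \<alpha> $ z \<le> 2"
          by (rule le) (auto simp: linear_iff algebra_simps T_def real_vec_def nth)
        ultimately show ?thesis
          unfolding real_vec_def vec_lambda_beta by linarith
      qed
      have s: "\<alpha> $ k + \<alpha>' $ k = \<beta> $ k" for k
        using sum by (metis vector_add_component)
      have "\<alpha> $ x + \<alpha>' $ x = 1" "\<alpha> $ y + \<alpha>' $ y = 1" "\<alpha> $ z + \<alpha>' $ z = 1"
        using s[of x] s[of y] s[of z] by (simp_all add: \<beta>_def nth)
      moreover from this have "\<alpha> $ x = 0 \<or> \<alpha> $ x = 1" "\<alpha> $ y = 0 \<or> \<alpha> $ y = 1" "\<alpha> $ z = 0 \<or> \<alpha> $ z = 1"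
        by linarith+
      ultimately have False
        using bounds[OF \<alpha>(1)] bounds[OF \<alpha>(2)] by (elim disjE) auto
      then show ?thesis ..
    qed
  qed
qed

theorem proposition5p10:
  fixes d :: nat
  assumes "d \<ge> 1"
    and "CARD('n::finite) = 1 \<Longrightarrow> d = 1"
  shows "(sos d \<union> sonc (2 * d) :: 'n mpol set) = sos_plus_sonc d
           \<longleftrightarrow> hilbert_case CARD('n) (2 * d)"
proof
  assume hilbert: "hilbert_case CARD('n) (2 * d)"
  have "(0 :: 'n mpol) \<in> sonc (2 * d)"
    by (auto simp: sonc_def intro!: exI[of _ 0])
  \<comment> \<open>Since 0 is an empty sum of circuits and sums of nonnegative circuits are sums of
    squares, both sides equal \<open>sos d\<close>.\<close>
  then have "s \<in> sos_plus_sonc d" if "s \<in> sos d" for s :: "'n mpol"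
    unfolding sos_plus_sonc_def using that by force
  moreover have "s \<in> sos d" if "s \<in> sos_plus_sonc d" for s :: "'n mpol"
    using that sonc_subset_sos[OF hilbert] by (auto simp: sos_plus_sonc_def intro!: sos_add)
  ultimately show "(sos d \<union> sonc (2 * d) :: 'n mpol set) = sos_plus_sonc d"
    using sonc_subset_sos[OF hilbert] by blast
next
  assume eq: "(sos d \<union> sonc (2 * d) :: 'n mpol set) = sos_plus_sonc d"
  show "hilbert_case CARD('n) (2 * d)"
  proof (rule ccontr)
    assume "\<not> ?thesis"
    then have "CARD('n) \<noteq> 2" "d \<noteq> 1" "CARD('n) \<noteq> 3 \<or> d \<noteq> 2" "CARD('n) \<noteq> 1" "CARD('n) \<noteq> 0"
      using assms(2) by (auto simp: hilbert_case_def)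
    \<comment> \<open>One variable is excluded because it forces \<open>d = 1\<close>, a Hilbert
      case. In both remaining ranges the witness uses three or four of the variables and the others
      do not occur in it.\<close>
    then consider "CARD('n) \<ge> 3" "d \<ge> 3" | "CARD('n) \<ge> 4" "d = 2"
      using assms(1) by linarith
    then show False
    proof cases
      case 1
      then obtain S where "card S = 3" "S \<subseteq> (UNIV :: 'n set)"
        by (meson obtain_subset_with_card_n)
      then obtain x y z :: 'n where "distinct [x, y, z]"
        by (auto simp: card_3_iff)
      then show False
        using ternary_not_union 1(2) eq by blast
    next
      case 2
      then obtain S where S: "card S = 4" "S \<subseteq> (UNIV :: 'n set)"
        by (meson obtain_subset_with_card_n)
      then obtain x y z w :: 'n where "distinct [x, y, z, w]"
        by (auto simp: card_Suc_eq numeral_eq_Suc)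
      then show False
        using quaternary_quartic_not_union eq 2(2) by blast
    qed
  qed
qed

end
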